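(* Let $\mathcal A,\mathcal B$ be finite graphs, $\Gamma$ a family of $\mathcal A$-labelled graphs and $\Delta$ a family of $\mathcal B$-labelled graphs. Assume there is a finite $(\mathcal A,\mathcal B)$-simulator $\mathcal S$ such that: (1) for every $\mathcal H\in\Delta$ there is $\mathcal G\in\Gamma$ such that $\mathcal G\rtimes\mathcal S$ is weakly étale and weakly maps to $\mathcal H$; (2) for every $\mathcal G\in\Gamma$ there is $\mathcal H\in\Delta$ that weakly maps to $\mathcal G\rtimes\mathcal S$. If the tiling problem for $\Gamma$ is solvable, then so is the tiling problem for $\Delta$.
   Context: **Graphs and morphisms.** A graph $\mathcal G$ consists of disjoint sets $V(\mathcal G)$ and $E(\mathcal G)$, with tail and head maps $e\mapsto e^\mp$ from $E$ to $V$. Morphisms preserve vertices, edges, heads and tails. A path is a sequence of edges $(e_1,\dots,e_n)$, $n\ge1$, with $e_i^+=e_{i+1}^-$. **Labelled graphs.** An $\mathcal A$-labelled graph is a graph with a morphism to $\mathcal A$. Morphisms of $\mathcal A$-labelled graphs are graph morphisms commuting with labellings, forming the set $\mathrm{Graph}_{/\mathcal A}(\cdot,\cdot)$. A labelled graph is weakly étale if any two edges with the same label sharing a tail or sharing a head have the same tail and the same head. A labelled graph $\mathcal G$ weakly maps to $\mathcal H$ if $\mathrm{Graph}_{/\mathcal A}(\mathcal G',\mathcal H)\ne\emptyset$ for every finite subgraph $\mathcal G'$ of $\mathcal G$. **Path subdivision.** The path subdivision $\mathcal B^*$ has vertex set $V(\mathcal B)\sqcup E(\mathcal B)$ and edges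 $(i,e,j)\in\{0,1\}\times E(\mathcal B)\times\{0,1\}$, with: - $(0,e,0)^\pm=e^\pm$; - $(0,e,1)^-=e^-$ and $(0,e,1)^+=e$; - $(1,e,1)^\pm=e$; - $(1,e,0)^-=e$ and $(1,e,0)^+=e^+$. For a $\mathcal B^*$-labelled graph $(\mathcal K,\kappa)$, a coherent path is a path $(e_1,\dots,e_n)$ with $\kappa(e_i)=(\mathbf 1_{i\ne1},c,\mathbf 1_{i\ne n})$ for some $c\in E(\mathcal B)$. Then $\mathcal K^\flat$ is the $\mathcal B$-labelled graph whose vertices are the vertices of $\mathcal K$ with label in $V(\mathcal B)$ (same label), with one edge labelled $c$ from first to last vertex for each coherent path. **Simulators.** An $(\mathcal A,\mathcal B)$-simulator is a graph $\mathcal S$ with morphisms $\alpha_{\mathcal S}\colon\mathcal S\to\mathcal A$ and $\beta_{\mathcal S}\colon\mathcal S\to\mathcal B^*$. For $(\mathcal G,\alpha)$ $\mathcal A$-labelled, the pullback $\mathcal G\times_{\mathcal A}\mathcal S$ consists of pairs (vertex, vertex) or (edge, edge) with equal $\mathcal A$-labels, with $(e,f)^\pm=(e^\pm,f^\pm)$. It is $\mathcal B^*$-labelled via $\beta_{\mathcal S}$ on the second coordinate. Set $\mathcal G\rtimes\mathcal S=(\mathcal G\times_{\mathcal A}\mathcal S)^\flat$. **Tiling problem for a family.** The tiling problem for a family $\Gamma$ of $\mathcal A$-labelled graphs asks: given a finite $\mathcal A$-labelled graph $\mathcal F$, decide whether $\mathrm{Graph}_{/\mathcal A}(\mathcal G,\mathcal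 F)\ne\emptyset$ for at least one $\mathcal G\in\Gamma$. It is solvable if an algorithm decides it. *)

theory Defs
  imports "Graph_Theory.Digraph_Component" "HOL-Library.Nat_Bijection"
begin

section \<open>Labelled graphs\<close>

text \<open>
  Graphs are the digraphs of \<^theory>\<open>Graph_Theory.Digraph\<close> (loops and parallel arcs allowed,
  possibly infinite). Vertices and arcs live in different types, which makes them disjoint.
\<close>

definition graph_hom ::
  "('v, 'e) pre_digraph \<Rightarrow> ('w, 'f) pre_digraph \<Rightarrow> ('v \<Rightarrow> 'w) \<Rightarrow> ('e \<Rightarrow> 'f) \<Rightarrow> bool" where
  "graph_hom G H f g \<longleftrightarrow> wf_digraph G \<and> wf_digraph H
     \<and> (\<forall>v \<in> verts G. f v \<in> verts H)
     \<and> (\<forall>e \<in> arcs G. g e \<in> arcs H \<and> tail H (g e) = f (tail G e) \<and> head H (g e) = f (head G e))"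

record ('v, 'e, 'a, 'b) lgraph =
  gr :: "('v, 'e) pre_digraph"
  vlab :: "'v \<Rightarrow> 'a"
  elab :: "'e \<Rightarrow> 'b"

definition labelled :: "('a, 'b) pre_digraph \<Rightarrow> ('v, 'e, 'a, 'b) lgraph \<Rightarrow> bool" where
  "labelled A G \<longleftrightarrow> graph_hom (gr G) A (vlab G) (elab G)"

text \<open>
  The maps of a morphism are unconstrained outside the vertex and arc sets of the source;
  only whether the set of morphisms is empty will matter.
\<close>

definition lgraph_homs ::
  "('v, 'e, 'a, 'b) lgraph \<Rightarrow> ('w, 'f, 'a, 'b) lgraph \<Rightarrow> (('v \<Rightarrow> 'w) \<times> ('e \<Rightarrow> 'f)) set" where
  "lgraph_homs G H = {(f, g). graph_hom (gr G) (gr H) f g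
     \<and> (\<forall>v \<in> verts (gr G). vlab H (f v) = vlab G v)
     \<and> (\<forall>e \<in> arcs (gr G). elab H (g e) = elab G e)}"

definition weakly_etale :: "('v, 'e, 'a, 'b) lgraph \<Rightarrow> bool" where
  "weakly_etale G \<longleftrightarrow> (\<forall>e \<in> arcs (gr G). \<forall>f \<in> arcs (gr G).
     elab G e = elab G f \<longrightarrow>
     tail (gr G) e = tail (gr G) f \<or> head (gr G) e = head (gr G) f \<longrightarrow>
     tail (gr G) e = tail (gr G) f \<and> head (gr G) e = head (gr G) f)"

definition weakly_maps :: "('v, 'e, 'a, 'b) lgraph \<Rightarrow> ('w, 'f, 'a, 'b) lgraph \<Rightarrow> bool" where
  "weakly_maps G H \<longleftrightarrow>
     (\<forall>K. subgraph K (gr G) \<and> fin_digraph K \<longrightarrow> lgraph_homs (G\<lparr>gr := K\<rparr>) H \<noteq> {})"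


section \<open>Path subdivision and simulators\<close>

text \<open>In an arc \<open>(i, e, j)\<close> of the path subdivision, \<open>False\<close> stands for 0 and \<open>True\<close> for 1.\<close>

definition path_subdivision ::
  "('c, 'd) pre_digraph \<Rightarrow> ('c + 'd, bool \<times> 'd \<times> bool) pre_digraph" where
  "path_subdivision B = \<lparr>
     verts = verts B <+> arcs B,
     arcs = UNIV \<times> arcs B \<times> UNIV,
     tail = (\<lambda>(i, e, j). if i then Inr e else Inl (tail B e)),
     head = (\<lambda>(i, e, j). if j then Inr e else Inl (head B e))\<rparr>"

text \<open>Positions are counted from 0, so the first arc has \<open>i = 0\<close> and the last one \<open>Suc i = length p\<close>.\<close>

definition coherent_path ::
  "('v, 'e, 'c + 'd, bool \<times> 'd \<times> bool) lgraph \<Rightarrow> 'd \<Rightarrow> 'e list \<Rightarrow> bool" where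
  "coherent_path K c p \<longleftrightarrow> p \<noteq> []
     \<and> pre_digraph.awalk (gr K) (tail (gr K) (hd p)) p (head (gr K) (last p))
     \<and> (\<forall>i < length p. elab K (p ! i) = (i \<noteq> 0, c, Suc i \<noteq> length p))"

definition flat ::
  "('v, 'e, 'c + 'd, bool \<times> 'd \<times> bool) lgraph \<Rightarrow> ('v, 'e list, 'c, 'd) lgraph" where
  "flat K = \<lparr>
     gr = \<lparr>verts = {v \<in> verts (gr K). isl (vlab K v)},
           arcs = {p. \<exists>c. coherent_path K c p},
           tail = (\<lambda>p. tail (gr K) (hd p)),
           head = (\<lambda>p. head (gr K) (last p))\<rparr>,
     vlab = (\<lambda>v. projl (vlab K v)),
     elab = (\<lambda>p. THE c. coherent_path K c p)\<rparr>"

record ('s, 't, 'a, 'b, 'c, 'd) simulator =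
  sgr :: "('s, 't) pre_digraph"
  alphav :: "'s \<Rightarrow> 'a"
  alphae :: "'t \<Rightarrow> 'b"
  betav :: "'s \<Rightarrow> 'c + 'd"
  betae :: "'t \<Rightarrow> bool \<times> 'd \<times> bool"

definition is_simulator ::
  "('a, 'b) pre_digraph \<Rightarrow> ('c, 'd) pre_digraph \<Rightarrow> ('s, 't, 'a, 'b, 'c, 'd) simulator \<Rightarrow> bool" where
  "is_simulator A B S \<longleftrightarrow> graph_hom (sgr S) A (alphav S) (alphae S)
     \<and> graph_hom (sgr S) (path_subdivision B) (betav S) (betae S)"

definition pullback ::
  "('v, 'e, 'a, 'b) lgraph \<Rightarrow> ('s, 't, 'a, 'b, 'c, 'd) simulator
     \<Rightarrow> ('v \<times> 's, 'e \<times> 't, 'c + 'd, bool \<times> 'd \<times> bool) lgraph" where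
  "pullback G S = \<lparr>
     gr = \<lparr>verts = {(v, s). v \<in> verts (gr G) \<and> s \<in> verts (sgr S) \<and> vlab G v = alphav S s},
           arcs = {(e, t). e \<in> arcs (gr G) \<and> t \<in> arcs (sgr S) \<and> elab G e = alphae S t},
           tail = (\<lambda>(e, t). (tail (gr G) e, tail (sgr S) t)),
           head = (\<lambda>(e, t). (head (gr G) e, head (sgr S) t))\<rparr>,
     vlab = (\<lambda>(v, s). betav S s),
     elab = (\<lambda>(e, t). betae S t)\<rparr>"

definition simulate ::
  "('v, 'e, 'a, 'b) lgraph \<Rightarrow> ('s, 't, 'a, 'b, 'c, 'd) simulator
     \<Rightarrow> ('v \<times> 's, ('e \<times> 't) list, 'c, 'd) lgraph"  (infixl \<open>\<rtimes>\<close> 70) where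
  "G \<rtimes> S = flat (pullback G S)"

lemma labelled_simulate:
  assumes G: "labelled A G" and S: "is_simulator A B S"
  shows "labelled B (G \<rtimes> S)"
proof -
  let ?K = "pullback G S"
  have wK: "wf_digraph (gr ?K)"
    using G S unfolding labelled_def is_simulator_def graph_hom_def pullback_def
    by (intro wf_digraph.intro) (auto simp: wf_digraph_def)
  have wB: "wf_digraph B"
  proof
    fix e assume e: "e \<in> arcs B"
    have w: "wf_digraph (path_subdivision B)"
      using S by (auto simp: is_simulator_def graph_hom_def)
    have "(False, e, False) \<in> arcs (path_subdivision B)"
      using e by (simp add: path_subdivision_def)
    from wf_digraph.tail_in_verts[OF w this] wf_digraph.head_in_verts[OF w this]
    show "tail B e \<in> verts B" "head B e \<in> verts B"
      by (auto simp: path_subdivision_def)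
  qed
  have KB: "graph_hom (gr ?K) (path_subdivision B) (vlab ?K) (elab ?K)"
    using S wK unfolding is_simulator_def graph_hom_def by (auto simp: pullback_def)
  have coh: "c \<in> arcs B \<and> tail (gr ?K) (hd p) \<in> verts (gr ?K) \<and> head (gr ?K) (last p) \<in> verts (gr ?K)
     \<and> vlab ?K (tail (gr ?K) (hd p)) = Inl (tail B c)
     \<and> vlab ?K (head (gr ?K) (last p)) = Inl (head B c)
     \<and> (THE c. coherent_path ?K c p) = c" if cp: "coherent_path ?K c p" for c p
  proof -
    from cp have ne: "p \<noteq> []" and sub: "set p \<subseteq> arcs (gr ?K)"
      and lab: "\<And>i. i < length p \<Longrightarrow> elab ?K (p ! i) = (i \<noteq> 0, c, Suc i \<noteq> length p)"
      by (auto simp: coherent_path_def pre_digraph.awalk_def)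
    have h: "hd p \<in> arcs (gr ?K)" "last p \<in> arcs (gr ?K)" using ne sub by auto
    have l1: "\<exists>j. elab ?K (hd p) = (False, c, j)" using lab[of 0] ne by (simp add: hd_conv_nth)
    have l2: "\<exists>i. elab ?K (last p) = (i, c, False)"
      using lab[of "length p - 1"] ne by (auto simp: last_conv_nth)
    have the: "(THE c. coherent_path ?K c p) = c"
    proof (rule the_equality)
      show "coherent_path ?K c p" by (fact cp)
      fix c' assume "coherent_path ?K c' p"
      then have "elab ?K (p ! 0) = (False, c', Suc 0 \<noteq> length p)"
        using ne by (auto simp: coherent_path_def)
      then show "c' = c" using lab[of 0] ne by auto
    qed
    have e1: "elab ?K (hd p) \<in> arcs (path_subdivision B)"
      "tail (path_subdivision B) (elab ?K (hd p)) = vlab ?K (tail (gr ?K) (hd p))"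
      using KB h(1) by (auto simp: graph_hom_def)
    have e2: "head (path_subdivision B) (elab ?K (last p)) = vlab ?K (head (gr ?K) (last p))"
      using KB h(2) by (auto simp: graph_hom_def)
    show ?thesis
      using e1 e2 l1 l2 the h wf_digraph.tail_in_verts[OF wK] wf_digraph.head_in_verts[OF wK]
      by (auto simp: path_subdivision_def)
  qed
  have Kv: "\<And>v. v \<in> verts (gr ?K) \<Longrightarrow> vlab ?K v \<in> verts B <+> arcs B"
    using KB by (auto simp: graph_hom_def path_subdivision_def)
  have wF: "wf_digraph (gr (flat ?K))"
  proof
    fix p assume "p \<in> arcs (gr (flat ?K))"
    then obtain c where "coherent_path ?K c p" by (auto simp: flat_def)
    from coh[OF this] show "tail (gr (flat ?K)) p \<in> verts (gr (flat ?K))"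
      "head (gr (flat ?K)) p \<in> verts (gr (flat ?K))" by (auto simp: flat_def)
  qed
  show ?thesis unfolding labelled_def simulate_def graph_hom_def
  proof (intro conjI ballI wF wB)
    fix v assume "v \<in> verts (gr (flat ?K))"
    then show "vlab (flat ?K) v \<in> verts B" using Kv[of v] by (auto simp: flat_def)
  next
    fix p assume "p \<in> arcs (gr (flat ?K))"
    then obtain c where "coherent_path ?K c p" by (auto simp: flat_def)
    from coh[OF this] show "elab (flat ?K) p \<in> arcs B"
      "tail B (elab (flat ?K) p) = vlab (flat ?K) (tail (gr (flat ?K)) p)"
      "head B (elab (flat ?K) p) = vlab (flat ?K) (head (gr (flat ?K)) p)"
      by (auto simp: flat_def)
  qed
qed


section \<open>Algorithms\<close>

text \<open>
  Algorithms are programs for partial recursive functions on the natural numbers: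
  \<open>computes p xs y\<close> states that \<open>p\<close> halts on input \<open>xs\<close> with output \<open>y\<close>.
\<close>

datatype recfn =
    Zero
  | Succ
  | Proj nat
  | Comp recfn "recfn list"
  | PrimRec recfn recfn
  | Mu recfn

inductive computes :: "recfn \<Rightarrow> nat list \<Rightarrow> nat \<Rightarrow> bool" where
  Zero: "computes Zero xs 0"
| Succ: "computes Succ [x] (Suc x)"
| Proj: "i < length xs \<Longrightarrow> computes (Proj i) xs (xs ! i)"
| Comp: "length ys = length gs \<Longrightarrow> (\<forall>i < length gs. computes (gs ! i) xs (ys ! i)) \<Longrightarrow>
    computes f ys z \<Longrightarrow> computes (Comp f gs) xs z"
| PrimRec_0: "computes f xs y \<Longrightarrow> computes (PrimRec f g) (0 # xs) y"
| PrimRec_Suc: "computes (PrimRec f g) (n # xs) y \<Longrightarrow> computes g (n # y # xs) z \<Longrightarrow>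
    computes (PrimRec f g) (Suc n # xs) z"
| Mu: "computes f (n # xs) 0 \<Longrightarrow> (\<forall>m < n. \<exists>y. computes f (m # xs) (Suc y)) \<Longrightarrow>
    computes (Mu f) xs n"

inductive_cases computes_ZeroE: "computes Zero xs y"
inductive_cases computes_SuccE: "computes Succ xs y"
inductive_cases computes_ProjE: "computes (Proj i) xs y"
inductive_cases computes_CompE: "computes (Comp f gs) xs y"
inductive_cases computes_PrimRec_0E: "computes (PrimRec f g) (0 # xs) y"
inductive_cases computes_PrimRec_SucE: "computes (PrimRec f g) (Suc n # xs) y"
inductive_cases computes_MuE: "computes (Mu f) xs y"

lemma computes_deterministic:
  "computes p xs y \<Longrightarrow> computes p xs z \<Longrightarrow> y = z"
proof (induction arbitrary: z rule: computes.induct)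
  case (Zero xs)
  then show ?case by (elim computes_ZeroE) simp
next
  case (Succ x)
  then show ?case by (elim computes_SuccE) simp
next
  case (Proj i xs)
  from Proj.prems show ?case by (elim computes_ProjE) simp
next
  case (Comp ys gs xs f y)
  from Comp.prems obtain ys' where ys': "length ys' = length gs"
    "\<forall>i < length gs. computes (gs ! i) xs (ys' ! i)" "computes f ys' z"
    by (elim computes_CompE)
  have "ys = ys'" using Comp.hyps(1) Comp.IH(1) ys'(1,2) by (intro nth_equalityI) auto
  then show ?case using Comp.IH(2) ys'(3) by blast
next
  case (PrimRec_0 f xs y g)
  from PrimRec_0.prems have "computes f xs z" by (elim computes_PrimRec_0E)
  then show ?case by (rule PrimRec_0.IH)
next
  case (PrimRec_Suc f g n xs y w)
  from PrimRec_Suc.prems obtain y' where "computes (PrimRec f g) (n # xs) y'"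
    "computes g (n # y' # xs) z" by (elim computes_PrimRec_SucE)
  then show ?case using PrimRec_Suc.IH by blast
next
  case (Mu f n xs)
  from Mu.prems have z: "computes f (z # xs) 0" "\<forall>m < z. \<exists>y. computes f (m # xs) (Suc y)"
    by (blast elim: computes_MuE)+
  show ?case
  proof (rule linorder_cases[of n z])
    assume "n < z"
    then obtain y where "computes f (n # xs) (Suc y)" using z(2) by blast
    from Mu.IH(1)[OF this] show ?thesis by simp
  next
    assume "z < n"
    then obtain y where "\<forall>u. computes f (z # xs) u \<longrightarrow> Suc y = u" using Mu.IH(2) by blast
    from this[rule_format, OF z(1)] show ?thesis by simp
  qed
qed


section \<open>Tiling problems\<close>

text \<open>
  A finite labelled graph is given to an algorithm in standard form: its vertices are
  \<open>0, \<dots>, m - 1\<close> and its arcs are \<open>0, \<dots>, n - 1\<close>. Its code consists of the list of the labels of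
  the vertices and the list of the tails, heads and labels of the arcs, where the vertices and
  arcs of the finite graph of labels are numbered by \<open>\<nu>\<close> and \<open>\<epsilon>\<close>. Up to isomorphism
  every finite labelled graph is of this form (\<open>ex_standard_lgraph\<close> below).
\<close>

definition standard_lgraph :: "(nat, nat, 'a, 'b) lgraph \<Rightarrow> bool" where
  "standard_lgraph F \<longleftrightarrow> (\<exists>m. verts (gr F) = {..<m}) \<and> (\<exists>n. arcs (gr F) = {..<n})"

definition code_lgraph ::
  "('a \<Rightarrow> nat) \<Rightarrow> ('b \<Rightarrow> nat) \<Rightarrow> (nat, nat, 'a, 'b) lgraph \<Rightarrow> nat" where
  "code_lgraph \<nu> \<epsilon> F = prod_encode
     (list_encode (map (\<lambda>v. \<nu> (vlab F v)) [0..<card (verts (gr F))]),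
      list_encode (map (\<lambda>e. prod_encode (tail (gr F) e, prod_encode (head (gr F) e, \<epsilon> (elab F e))))
        [0..<card (arcs (gr F))]))"

text \<open>
  As \<open>A\<close> is finite, solvability does not depend on the numbering \<open>\<nu>\<close>, \<open>\<epsilon>\<close> of its vertices and
  arcs, so we ask for an algorithm for each of them. Inputs that do not code a finite labelled
  graph are irrelevant.
\<close>

definition tiling_solvable ::
  "('a, 'b) pre_digraph \<Rightarrow> ('v, 'e, 'a, 'b) lgraph set \<Rightarrow> bool" where
  "tiling_solvable A \<Gamma> \<longleftrightarrow>
     (\<forall>\<nu> \<epsilon>. inj_on \<nu> (verts A) \<and> inj_on \<epsilon> (arcs A) \<longrightarrow>
       (\<exists>p. \<forall>F :: (nat, nat, 'a, 'b) lgraph. labelled A F \<and> standard_lgraph F \<longrightarrow>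
         computes p [code_lgraph \<nu> \<epsilon> F] (if \<exists>G \<in> \<Gamma>. lgraph_homs G F \<noteq> {} then 1 else 0)))"

lemma ex_standard_lgraph:
  assumes F: "labelled A F" and fin: "fin_digraph (gr F)"
  obtains F' :: "(nat, nat, 'a, 'b) lgraph" and f g where
    "labelled A F'" "standard_lgraph F'"
    "(f, g) \<in> lgraph_homs F F'" "bij_betw f (verts (gr F)) (verts (gr F'))"
    "bij_betw g (arcs (gr F)) (arcs (gr F'))"
    "(inv_into (verts (gr F)) f, inv_into (arcs (gr F)) g) \<in> lgraph_homs F' F"
proof -
  let ?V = "verts (gr F)" and ?E = "arcs (gr F)"
  have w: "wf_digraph (gr F)" and wA: "wf_digraph A" using F by (auto simp: labelled_def graph_hom_def)
  obtain f where f: "bij_betw f ?V {..<card ?V}"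
    using ex_bij_betw_finite_nat[of ?V] fin
    by (auto simp: fin_digraph_def fin_digraph_axioms_def atLeast0LessThan)
  obtain g where g: "bij_betw g ?E {..<card ?E}"
    using ex_bij_betw_finite_nat[of ?E] fin
    by (auto simp: fin_digraph_def fin_digraph_axioms_def atLeast0LessThan)
  let ?f = "inv_into ?V f" and ?g = "inv_into ?E g"
  define F' where "F' = \<lparr>gr = \<lparr>verts = {..<card ?V}, arcs = {..<card ?E},
     tail = (\<lambda>e. f (tail (gr F) (?g e))), head = (\<lambda>e. f (head (gr F) (?g e)))\<rparr>,
     vlab = (\<lambda>v. vlab F (?f v)), elab = (\<lambda>e. elab F (?g e))\<rparr>"
  have fi: "\<And>v. v \<in> ?V \<Longrightarrow> ?f (f v) = v \<and> f v < card ?V"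
    using f by (auto simp: bij_betw_def)
  have gi: "\<And>v. v \<in> ?E \<Longrightarrow> ?g (g v) = v \<and> g v < card ?E"
    using g by (auto simp: bij_betw_def)
  have fj: "\<And>v. v < card ?V \<Longrightarrow> ?f v \<in> ?V" using f
    by (metis bij_betw_def inv_into_into lessThan_iff)
  have gj: "\<And>v. v < card ?E \<Longrightarrow> ?g v \<in> ?E" using g
    by (metis bij_betw_def inv_into_into lessThan_iff)
  have te: "\<And>e. e \<in> ?E \<Longrightarrow> tail (gr F) e \<in> ?V" "\<And>e. e \<in> ?E \<Longrightarrow> head (gr F) e \<in> ?V"
    using w by (auto simp: wf_digraph_def)
  have w': "wf_digraph (gr F')"
    by (rule wf_digraph.intro) (auto simp: F'_def fi gj te)
  show ?thesis
  proof
    show "labelled A F'" using F w' wA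
      by (auto simp: labelled_def graph_hom_def F'_def fi gj fj te)
    show "standard_lgraph F'" by (auto simp: standard_lgraph_def F'_def)
    show "(f, g) \<in> lgraph_homs F F'" using w w'
      by (auto simp: lgraph_homs_def graph_hom_def F'_def fi gi te)
    show "bij_betw f ?V (verts (gr F'))" "bij_betw g ?E (arcs (gr F'))"
      using f g by (auto simp: F'_def)
    show "(?f, ?g) \<in> lgraph_homs F' F" using w w'
      by (auto simp: lgraph_homs_def graph_hom_def F'_def fi gi fj gj te)
  qed
qed

end

theory Submission
  imports Defs "HOL-Analysis.Function_Topology"
begin

text \<open>
  From a finite \<open>B\<close>-labelled graph \<open>F\<close> one computes a finite \<open>A\<close>-labelled graph \<open>F'\<close> such that
  \<open>G\<close> maps to \<open>F'\<close> if and only if \<open>G \<rtimes> S\<close> maps to \<open>F\<close>, the direction from right to left requiring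
  \<open>G \<rtimes> S\<close> to be weakly etale. A vertex of \<open>F'\<close> over \<open>a\<close> assigns a state to every vertex of \<open>S\<close> over
  \<open>a\<close>, the states describing how \<open>F\<close> is traversed by the coherent paths of the pullback. As \<open>F\<close> is
  finite, by Tychonoff's theorem any graph that weakly maps to \<open>F\<close> maps to \<open>F\<close>. So some member of \<open>\<Delta>\<close>
  maps to \<open>F\<close> if and only if some member of \<open>\<Gamma>\<close> maps to \<open>F'\<close>.
\<close>

section \<open>Computable functions\<close>

text \<open>Coherent paths can be arbitrarily long and members of \<Gamma> infinite, while a
  morphism to the finite target is tested one vertex and one arc at a time. So the arc of
  \<open>F\<close> to which a coherent path is sent is stored at every inner vertex of the path and
  handed on along its arcs. Two obstacles shape the states. Inner vertices on no coherent path need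
  a state even if \<open>F\<close> has no arc with their label; the extra states 0 and 1 serve them,
  0 being handed on forwards and 1 backwards, so that neither can occur in the interior of a
  complete coherent path. And several coherent paths may cross at an inner vertex, which stores only
  one arc; weak etaleness gives all of them the same ends, so one arc of \<open>F\<close> fits them
  all. The hypotheses on the families speak of finite subgraphs only, hence the need for compactness
  before morphisms can be composed. For computability, \<open>A\<close> and \<open>S\<close> are
  constants: the target is obtained by filtering all codes below a bound computed from the code of
  \<open>F\<close> by conditions that are decidable from that code.\<close>

text \<open>
  The argument \<open>x\<close> of \<open>f\<close> may be any tuple; a program only sees the numbers \<open>v x\<close> for \<open>v\<close> in \<open>vs\<close>.
  A bound variable is pushed onto this environment by \<open>bind_env\<close>, so that bounded sums and
  quantifiers are handled by compositional introduction rules.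
\<close>

definition rec_in :: "('x \<Rightarrow> nat) list \<Rightarrow> ('x \<Rightarrow> nat) \<Rightarrow> bool" where
  "rec_in vs f \<longleftrightarrow> (\<exists>p. \<forall>x. computes p (map (\<lambda>v. v x) vs) (f x))"

definition dec_in :: "('x \<Rightarrow> nat) list \<Rightarrow> ('x \<Rightarrow> bool) \<Rightarrow> bool" where
  "dec_in vs P \<longleftrightarrow> rec_in vs (\<lambda>x. of_bool (P x))"

definition bind_env :: "('x \<Rightarrow> nat) list \<Rightarrow> (nat \<times> 'x \<Rightarrow> nat) list" where
  "bind_env vs = fst # map (\<lambda>v z. v (snd z)) vs"

named_theorems rec_intros

lemma rec_in_var: "v \<in> set vs \<Longrightarrow> rec_in vs v"
  unfolding rec_in_def in_set_conv_nth
  by (metis (no_types, lifting) Proj length_map nth_map)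

text \<open>Substitution along \<open>h\<close>, which may change the type of the tuple; with it
  bound variables are introduced, skipped or instantiated.\<close>

lemma rec_in_comp:
  assumes "rec_in ws g" and "\<And>w. w \<in> set ws \<Longrightarrow> rec_in vs (\<lambda>x. w (h x))"
  shows "rec_in vs (\<lambda>x. g (h x))"
proof -
  obtain p where p: "\<And>y. computes p (map (\<lambda>w. w y) ws) (g y)"
    using assms(1) by (auto simp: rec_in_def)
  obtain q where q: "\<And>w x. w \<in> set ws \<Longrightarrow> computes (q w) (map (\<lambda>v. v x) vs) (w (h x))"
    using assms(2) unfolding rec_in_def by metis
  have "computes (Comp p (map q ws)) (map (\<lambda>v. v x) vs) (g (h x))" for x
    by (rule Comp[where ys = "map (\<lambda>w. w (h x)) ws"]) (auto simp: p q)
  then show ?thesis unfolding rec_in_def by blast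
qed

lemma rec_in_bound [rec_intros]: "rec_in (bind_env vs) fst"
  by (rule rec_in_var) (simp add: bind_env_def)

lemma rec_in_weaken:
  assumes "rec_in vs f" shows "rec_in (bind_env vs) (\<lambda>z. f (snd z))"
  using assms by (rule rec_in_comp) (auto simp: bind_env_def intro: rec_in_var)

section \<open>Closure under primitive recursion and arithmetic\<close>

lemma rec_in_Suc [rec_intros]: "rec_in vs f \<Longrightarrow> rec_in vs (\<lambda>x. Suc (f x))"
proof -
  assume "rec_in vs f"
  then obtain p where p: "\<And>x. computes p (map (\<lambda>v. v x) vs) (f x)" by (auto simp: rec_in_def)
  have "computes (Comp Succ [p]) (map (\<lambda>v. v x) vs) (Suc (f x))" for x
    by (rule Comp[where ys = "[f x]"]) (auto intro: computes.intros p)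
  then show ?thesis unfolding rec_in_def by blast
qed

lemma rec_in_const [rec_intros]: "rec_in vs (\<lambda>x. n)"
proof (induction n)
  case 0
  show ?case unfolding rec_in_def by (blast intro: computes.Zero)
qed (rule rec_in_Suc)

lemma rec_in_rec_nat [rec_intros]:
  assumes "rec_in vs b"
    and "rec_in (bind_env (bind_env vs)) (\<lambda>z. s (fst z) (fst (snd z)) (snd (snd z)))"
    and "rec_in vs N"
  shows "rec_in vs (\<lambda>x. rec_nat (b x) (\<lambda>i y. s i y x) (N x))"
proof -
  obtain pb ps where pb: "\<And>x. computes pb (map (\<lambda>v. v x) vs) (b x)"
    and ps: "\<And>i y x. computes ps (i # y # map (\<lambda>v. v x) vs) (s i y x)"
    using assms(1,2) by (auto simp: rec_in_def bind_env_def comp_def)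
  have "computes (PrimRec pb ps) (n # map (\<lambda>v. v x) vs) (rec_nat (b x) (\<lambda>i y. s i y x) n)" for n x
    by (induction n) (auto intro: computes.intros pb ps)
  \<comment> \<open>\<open>PrimRec\<close> recurses on its first argument, so the counter is first a
    bound variable; \<open>N x\<close> is substituted for it afterwards.\<close>
  then have "rec_in (bind_env vs) (\<lambda>z. rec_nat (b (snd z)) (\<lambda>i y. s i y (snd z)) (fst z))"
    by (auto simp: rec_in_def bind_env_def comp_def)
  moreover have "rec_in vs (\<lambda>x. w (N x, x))" if "w \<in> set (bind_env vs)" for w
    using that assms(3) by (auto simp: bind_env_def intro: rec_in_var)
  ultimately show ?thesis using rec_in_comp[where h = "\<lambda>x. (N x, x)"] by force
qed

lemma rec_in_add [rec_intros]:
  assumes "rec_in vs f" "rec_in vs g" shows "rec_in vs (\<lambda>x. f x + g x)"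
proof -
  have "rec_in vs (\<lambda>x. rec_nat (f x) (\<lambda>_ y. Suc y) (g x))"
    by (intro rec_intros rec_in_weaken assms)
  moreover have "rec_nat a (\<lambda>_ y. Suc y) n = a + n" for a n :: nat by (induction n) auto
  ultimately show ?thesis by simp
qed

lemma rec_in_diff [rec_intros]:
  assumes "rec_in vs f" "rec_in vs g" shows "rec_in vs (\<lambda>x. f x - g x)"
proof -
  have "rec_in vs (\<lambda>x. rec_nat (f x) (\<lambda>_ y. rec_nat 0 (\<lambda>i _. i) y) (g x))"
    by (intro rec_intros rec_in_weaken assms)
  moreover have "rec_nat 0 (\<lambda>i _. i) y = y - 1" for y :: nat by (cases y) auto
  moreover have "rec_nat a (\<lambda>_ y. y - 1) n = a - n" for a n :: nat by (induction n) auto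
  ultimately show ?thesis by simp
qed

lemma rec_in_mult [rec_intros]:
  assumes "rec_in vs f" "rec_in vs g" shows "rec_in vs (\<lambda>x. f x * g x)"
proof -
  have "rec_in vs (\<lambda>x. rec_nat 0 (\<lambda>_ y. y + f x) (g x))"
    by (intro rec_intros rec_in_weaken assms)
  moreover have "rec_nat 0 (\<lambda>_ y. y + a) n = a * n" for a n :: nat by (induction n) auto
  ultimately show ?thesis by simp
qed

section \<open>Decidable predicates, bounded sums and quantifiers\<close>

lemma dec_in_le [rec_intros]:
  assumes "rec_in vs f" "rec_in vs g" shows "dec_in vs (\<lambda>x. f x \<le> g x)"
proof -
  have "rec_in vs (\<lambda>x. 1 - (f x - g x))" by (intro rec_intros assms)
  moreover have "1 - (a - b) = of_bool (a \<le> b)" for a b :: nat by auto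
  ultimately show ?thesis by (simp add: dec_in_def)
qed

lemma dec_in_less [rec_intros]:
  "rec_in vs f \<Longrightarrow> rec_in vs g \<Longrightarrow> dec_in vs (\<lambda>x. f x < g x)"
  using dec_in_le[OF rec_in_Suc] by (simp add: Suc_le_eq)

lemma dec_in_conj [rec_intros]:
  "dec_in vs P \<Longrightarrow> dec_in vs Q \<Longrightarrow> dec_in vs (\<lambda>x. P x \<and> Q x)"
  unfolding dec_in_def using rec_in_mult[of vs "\<lambda>x. of_bool (P x)" "\<lambda>x. of_bool (Q x)"] by (simp add: of_bool_conj)

lemma dec_in_not [rec_intros]:
  assumes "dec_in vs P" shows "dec_in vs (\<lambda>x. \<not> P x)"
proof -
  have "rec_in vs (\<lambda>x. 1 - of_bool (P x))" by (intro rec_intros assms[unfolded dec_in_def])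
  moreover have "1 - of_bool b = (of_bool (\<not> b) :: nat)" for b by simp
  ultimately show ?thesis by (simp only: dec_in_def)
qed

lemma dec_in_disj [rec_intros]:
  "dec_in vs P \<Longrightarrow> dec_in vs Q \<Longrightarrow> dec_in vs (\<lambda>x. P x \<or> Q x)"
  using dec_in_not[OF dec_in_conj[OF dec_in_not dec_in_not]] by simp

lemma dec_in_eq [rec_intros]:
  "rec_in vs f \<Longrightarrow> rec_in vs g \<Longrightarrow> dec_in vs (\<lambda>x. f x = g x)"
  by (subst order_eq_iff) (intro rec_intros)

lemma dec_in_const [rec_intros]: "dec_in vs (\<lambda>x. P)"
  unfolding dec_in_def by (rule rec_in_const)

lemma rec_in_if [rec_intros]:
  assumes "dec_in vs P" "rec_in vs f" "rec_in vs g"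
  shows "rec_in vs (\<lambda>x. if P x then f x else g x)"
proof -
  have "rec_in vs (\<lambda>x. rec_nat (g x) (\<lambda>_ _. f x) (of_bool (P x)))"
    by (intro rec_intros rec_in_weaken assms assms(1)[unfolded dec_in_def])
  moreover have "rec_nat b (\<lambda>_ _. a) (of_bool c) = (if c then a else b)" for a b :: nat and c by auto
  ultimately show ?thesis by simp
qed

text \<open>\<open>T\<close> is independent of \<open>x\<close>, so the quantifier is unrolled into
  the program. This serves for quantifiers over \<open>A\<close> and \<open>S\<close>.\<close>

lemma dec_in_finite_ball [rec_intros]:
  assumes "finite T" "\<And>t. t \<in> T \<Longrightarrow> dec_in vs (\<lambda>x. P x t)"
  shows "dec_in vs (\<lambda>x. \<forall>t\<in>T. P x t)"
  using assms by (induction T rule: finite_induct) (auto intro!: rec_intros)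

lemma dec_in_finite_bex [rec_intros]:
  assumes "finite T" "\<And>t. t \<in> T \<Longrightarrow> dec_in vs (\<lambda>x. P x t)"
  shows "dec_in vs (\<lambda>x. \<exists>t\<in>T. P x t)"
  using assms by (induction T rule: finite_induct) (auto intro!: rec_intros)

lemma rec_in_sum [rec_intros]:
  assumes "rec_in (bind_env vs) (\<lambda>z. f (fst z) (snd z))" "rec_in vs N"
  shows "rec_in vs (\<lambda>x. \<Sum>i<N x. f i x)"
proof -
  \<comment> \<open>The step function of the recursion also sees the accumulator, which the summand
    has to skip.\<close>
  have "rec_in (bind_env (bind_env vs)) (\<lambda>z. f (fst z) (snd (snd z)))"
    using rec_in_comp[OF assms(1), where h = "\<lambda>z. (fst z, snd (snd z))" and vs = "bind_env (bind_env vs)"]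
    by (force simp: bind_env_def intro: rec_in_var)
  then have "rec_in vs (\<lambda>x. rec_nat 0 (\<lambda>i y. y + f i x) (N x))"
    by (intro rec_intros rec_in_weaken assms)
  moreover have "rec_nat 0 (\<lambda>i y. y + f i x) n = (\<Sum>i<n. f i x)" for n x by (induction n) auto
  ultimately show ?thesis by simp
qed

lemma dec_in_bex_less [rec_intros]:
  assumes "dec_in (bind_env vs) (\<lambda>z. P (fst z) (snd z))" "rec_in vs N"
  shows "dec_in vs (\<lambda>x. \<exists>i<N x. P i x)"
proof -
  have "dec_in vs (\<lambda>x. \<not> (\<Sum>i<N x. of_bool (P i x) :: nat) = 0)"
    by (intro rec_intros assms assms(1)[unfolded dec_in_def])
  moreover have "((\<Sum>i<n. of_bool (P i x) :: nat) = 0) \<longleftrightarrow> \<not> (\<exists>i<n. P i x)" for n x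
    by auto
  ultimately show ?thesis by simp
qed

section \<open>Pairing and codes of lists\<close>

lemma rec_in_triangle:
  assumes "rec_in vs f" shows "rec_in vs (\<lambda>x. triangle (f x))"
proof -
  have "rec_in vs (\<lambda>x. rec_nat 0 (\<lambda>i y. y + Suc i) (f x))"
    by (intro rec_intros rec_in_weaken assms)
  moreover have "rec_nat 0 (\<lambda>i y. y + Suc i) n = triangle n" for n by (induction n) auto
  ultimately show ?thesis by simp
qed

lemma rec_in_prod_encode [rec_intros]:
  "rec_in vs f \<Longrightarrow> rec_in vs g \<Longrightarrow> rec_in vs (\<lambda>x. prod_encode (f x, g x))"
  unfolding prod_encode_def case_prod_conv by (intro rec_intros rec_in_triangle)

text \<open>Both components are bounded by the code, so a bounded search finds them. The search is a
  sum to which only the right candidate contributes.\<close>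

lemma rec_in_prod_decode [rec_intros]:
  assumes "rec_in vs f"
  shows "rec_in vs (\<lambda>x. fst (prod_decode (f x)))" and "rec_in vs (\<lambda>x. snd (prod_decode (f x)))"
proof -
  have sum: "(\<Sum>a<Suc z. if P a then a else 0) = c" if "P c" "\<And>a. P a \<Longrightarrow> a = c" "c \<le> z" for P z and c :: nat
  proof -
    have "P a \<longleftrightarrow> a = c" for a using that(1,2) by blast
    then show ?thesis using that(3) by (simp del: sum.lessThan_Suc)
  qed
  have le: "fst (prod_decode z) \<le> z" "snd (prod_decode z) \<le> z" for z
    using le_prod_encode_1[of "fst (prod_decode z)" "snd (prod_decode z)"]
      le_prod_encode_2[of "snd (prod_decode z)" "fst (prod_decode z)"] by simp_all
  have fst: "(\<Sum>a<Suc z. if \<exists>b<Suc z. prod_encode (a, b) = z then a else 0) = fst (prod_decode z)" for z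
    by (rule sum) (auto simp: le less_Suc_eq_le intro!: exI[of _ "snd (prod_decode z)"])
  have snd: "(\<Sum>b<Suc z. if \<exists>a<Suc z. prod_encode (a, b) = z then b else 0) = snd (prod_decode z)" for z
    by (rule sum) (auto simp: le less_Suc_eq_le intro!: exI[of _ "fst (prod_decode z)"])
  have "rec_in vs (\<lambda>x. \<Sum>a<Suc (f x). if \<exists>b<Suc (f x). prod_encode (a, b) = f x then a else 0)"
    by (intro rec_intros rec_in_weaken assms)
  then show "rec_in vs (\<lambda>x. fst (prod_decode (f x)))"
    unfolding fst .
  have "rec_in vs (\<lambda>x. \<Sum>b<Suc (f x). if \<exists>a<Suc (f x). prod_encode (a, b) = f x then b else 0)"
    by (intro rec_intros rec_in_weaken assms)
  then show "rec_in vs (\<lambda>x. snd (prod_decode (f x)))"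
    unfolding snd .
qed

lemma rec_in_drop:
  assumes "rec_in vs f" "rec_in vs i"
  shows "rec_in vs (\<lambda>x. list_encode (drop (i x) (list_decode (f x))))"
proof -
  have "rec_in vs (\<lambda>x. rec_nat (f x) (\<lambda>_ y. snd (prod_decode (y - 1))) (i x))"
    by (intro rec_intros rec_in_weaken assms)
  \<comment> \<open>The empty list has code 0 and must be fixed, as \<open>tl [] = []\<close>;
    truncated subtraction and this value achieve it.\<close>
  moreover have "prod_decode 0 = (0, 0)"
    using prod_encode_inverse[of "(0, 0)"] by (simp add: prod_encode_def)
  then have "snd (prod_decode (c - 1)) = list_encode (tl (list_decode c))" for c
    by (cases c) (auto simp: split_beta)
  then have "rec_nat c (\<lambda>_ y. snd (prod_decode (y - 1))) n = list_encode (drop n (list_decode c))" for c n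
    by (induction n) (auto simp: tl_drop drop_Suc)
  ultimately show ?thesis by simp
qed

definition list_code_nth :: "nat \<Rightarrow> nat \<Rightarrow> nat" where
  "list_code_nth c i = fst (prod_decode (list_encode (drop i (list_decode c)) - 1))"

lemma list_code_nth_encode [simp]:
  "i < length xs \<Longrightarrow> list_code_nth (list_encode xs) i = xs ! i"
  by (simp add: list_code_nth_def Cons_nth_drop_Suc[symmetric])

lemma rec_in_list_code_nth [rec_intros]:
  "rec_in vs f \<Longrightarrow> rec_in vs i \<Longrightarrow> rec_in vs (\<lambda>x. list_code_nth (f x) (i x))"
  unfolding list_code_nth_def by (intro rec_intros rec_in_drop)

lemma length_le_list_encode: "length xs \<le> list_encode xs"
  by (induction xs) (auto intro: le_trans[OF _ le_prod_encode_2])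

text \<open>The length is the number of positions at which something remains to be dropped; it is at
  most the code, which bounds the count.\<close>

lemma rec_in_length [rec_intros]:
  assumes "rec_in vs f" shows "rec_in vs (\<lambda>x. length (list_decode (f x)))"
proof -
  have "dec_in (bind_env vs) (\<lambda>z. \<not> list_encode (drop (fst z) (list_decode (f (snd z)))) = 0)"
    by (intro rec_intros rec_in_drop rec_in_weaken assms)
  then have "rec_in vs (\<lambda>x. \<Sum>i<f x. of_bool (\<not> list_encode (drop i (list_decode (f x))) = 0))"
    by (intro rec_intros assms) (simp add: dec_in_def)
  moreover have "(\<Sum>i<c. of_bool (\<not> list_encode (drop i (list_decode c)) = 0)) = length (list_decode c)" for c
  proof -
    have "list_encode xs = 0 \<longleftrightarrow> xs = []" for xs by (cases xs) auto
    then have "(\<Sum>i<c. of_bool (\<not> list_encode (drop i (list_decode c)) = 0) :: nat)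
        = card ({..<c} \<inter> {i. i < length (list_decode c)})"
      by (simp add: sum_of_bool_eq not_le)
    also have "{..<c} \<inter> {i. i < length (list_decode c)} = {..<length (list_decode c)}"
      using length_le_list_encode[of "list_decode c"] by auto
    finally show ?thesis by simp
  qed
  ultimately show ?thesis by simp
qed

lemma rec_in_map_filter [rec_intros]:
  assumes "rec_in (bind_env vs) (\<lambda>z. f (fst z) (snd z))"
    and "dec_in (bind_env vs) (\<lambda>z. P (fst z) (snd z))" and "rec_in vs N"
  shows "rec_in vs (\<lambda>x. list_encode (map (\<lambda>i. f i x) (filter (\<lambda>i. P i x) [0..<N x])))"
proof -
  \<comment> \<open>Lists grow at the front, so round \<open>j\<close> treats the index
    \<open>N x - Suc j\<close>, the last index coming first.\<close>
  let ?s = "\<lambda>j y x. if P (N x - Suc j) x then Suc (prod_encode (f (N x - Suc j) x, y)) else y"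
  let ?h = "\<lambda>z. (N (snd (snd z)) - Suc (fst z), snd (snd z))"
  have h: "rec_in (bind_env (bind_env vs)) (\<lambda>z. w (?h z))" if "w \<in> set (bind_env vs)" for w
  proof -
    have "w = fst \<or> (\<exists>v\<in>set vs. w = (\<lambda>z. v (snd z)))" using that by (auto simp: bind_env_def)
    moreover have "rec_in (bind_env (bind_env vs)) (\<lambda>z. v (snd (snd z)))" if "v \<in> set vs" for v
      using that by (intro rec_in_weaken rec_in_var)
    moreover have "rec_in (bind_env (bind_env vs)) (\<lambda>z. N (snd (snd z)) - Suc (fst z))"
      by (intro rec_intros rec_in_weaken assms(3))
    ultimately show ?thesis by auto
  qed
  have y: "rec_in (bind_env (bind_env vs)) (\<lambda>z. fst (snd z))"
    by (intro rec_in_weaken rec_in_bound)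
  have f: "rec_in (bind_env (bind_env vs)) (\<lambda>z. f (N (snd (snd z)) - Suc (fst z)) (snd (snd z)))"
    using rec_in_comp[where h = ?h, OF assms(1) h] by simp
  have P: "dec_in (bind_env (bind_env vs)) (\<lambda>z. P (N (snd (snd z)) - Suc (fst z)) (snd (snd z)))"
    using rec_in_comp[where h = ?h, OF assms(2)[unfolded dec_in_def] h] by (simp add: dec_in_def)
  have "rec_in vs (\<lambda>x. rec_nat 0 (\<lambda>j y. ?s j y x) (N x))"
    by (rule rec_in_rec_nat[OF rec_in_const _ assms(3)], rule rec_in_if[OF P _ y],
        rule rec_in_Suc, rule rec_in_prod_encode[OF f y])
  moreover have "rec_nat 0 (\<lambda>j y. ?s j y x) n
      = list_encode (map (\<lambda>i. f i x) (filter (\<lambda>i. P i x) [N x - n..<N x]))" if "n \<le> N x" for n x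
    using that
  proof (induction n)
    case (Suc n)
    then have "[N x - Suc n..<N x] = (N x - Suc n) # [N x - n..<N x]"
      by (subst upt_conv_Cons) (auto simp: Suc_diff_Suc)
    then show ?case using Suc by simp
  qed simp
  ultimately show ?thesis by simp
qed

lemma rec_in_replicate [rec_intros]:
  "rec_in vs f \<Longrightarrow> rec_in vs (\<lambda>x. list_encode (replicate k (f x)))"
  by (induction k) (auto intro!: rec_intros)

section \<open>Monotonicity of codes\<close>

lemma triangle_mono: "a \<le> b \<Longrightarrow> triangle a \<le> triangle b"
  by (induction rule: dec_induct) auto

lemma prod_encode_mono: "a \<le> c \<Longrightarrow> b \<le> d \<Longrightarrow> prod_encode (a, b) \<le> prod_encode (c, d)"
  by (simp add: prod_encode_def add_mono triangle_mono)

text \<open>This bounds the search for vertices of the target: the constant list with the largest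
  entry has the largest code among lists of its length.\<close>

lemma list_encode_mono: "list_all2 (\<le>) xs ys \<Longrightarrow> list_encode xs \<le> list_encode ys"
  by (induction rule: list_all2_induct) (auto simp: prod_encode_mono)

section \<open>Compactness\<close>

text \<open>Each constraint depends on finitely many coordinates, hence is closed in a product of
  finite discrete spaces, which is compact. The finite intersection property then yields a common
  solution.\<close>

lemma compactness_finite_choices:
  assumes "finite Y" and fin: "\<And>i. i \<in> I \<Longrightarrow> finite (D i) \<and> D i \<subseteq> V"
    and dep: "\<And>i f f'. i \<in> I \<Longrightarrow> (\<And>v. v \<in> D i \<Longrightarrow> f v = f' v) \<Longrightarrow> P i f \<Longrightarrow> P i f'"
    and sat: "\<And>J. finite J \<Longrightarrow> J \<subseteq> I \<Longrightarrow> \<exists>f. f ` V \<subseteq> Y \<and> (\<forall>j\<in>J. P j f)"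
  shows "\<exists>f. f ` V \<subseteq> Y \<and> (\<forall>i\<in>I. P i f)"
proof -
  let ?X = "product_topology (\<lambda>_. discrete_topology Y) V"
  let ?C = "\<lambda>i. {f \<in> PiE V (\<lambda>_. Y). P i f}"
  have compact: "compact_space ?X"
    using \<open>finite Y\<close> by (simp add: compact_space_product_topology compact_space_discrete_topology)
  have closed: "closedin ?X (?C i)" if i: "i \<in> I" for i
  proof -
    have "\<exists>U. finite {v \<in> V. U v \<noteq> Y} \<and> (\<forall>v\<in>V. U v \<subseteq> Y) \<and> x \<in> PiE V U \<and> PiE V U \<subseteq> {f \<in> PiE V (\<lambda>_. Y). \<not> P i f}"
      if x: "x \<in> PiE V (\<lambda>_. Y)" "\<not> P i x" for x
    proof (intro exI conjI)
      \<comment> \<open>The basic open box that freezes the coordinates on which constraint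
        \<open>i\<close> depends.\<close>
      let ?U = "\<lambda>v. if v \<in> D i then {x v} else Y"
      show "finite {v \<in> V. ?U v \<noteq> Y}"
        by (rule finite_subset[of _ "D i"]) (use fin[OF i] in auto)
      show "\<forall>v\<in>V. ?U v \<subseteq> Y" "x \<in> PiE V ?U" using x by (auto simp: PiE_iff)
      show "PiE V ?U \<subseteq> {f \<in> PiE V (\<lambda>_. Y). \<not> P i f}"
      proof
        fix f assume f: "f \<in> PiE V ?U"
        have "f v = x v" if "v \<in> D i" for v using f that fin[OF i] by (force simp: PiE_iff)
        then have "\<not> P i f" using dep[OF i, of f x] x(2) by blast
        moreover have "f \<in> PiE V (\<lambda>_. Y)"
          using f x(1) by (auto simp: PiE_iff split: if_splits)
        ultimately show "f \<in> {f \<in> PiE V (\<lambda>_. Y). \<not> P i f}" by simp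
      qed
    qed
    then have "openin ?X {f \<in> PiE V (\<lambda>_. Y). \<not> P i f}"
      by (simp add: openin_product_topology_alt)
    moreover have "PiE V (\<lambda>_. Y) - ?C i = {f \<in> PiE V (\<lambda>_. Y). \<not> P i f}" by auto
    ultimately show ?thesis by (auto simp: closedin_def)
  qed
  have top: "PiE V (\<lambda>_. Y) \<noteq> {}"
    using sat[of "{}"] by (auto simp: PiE_eq_empty_iff)
  \<comment> \<open>Without constraints the intersection below would be the whole type and not the
    product space.\<close>
  show ?thesis
  proof (cases "I = {}")
    case True
    then show ?thesis using sat[of "{}"] by simp
  next
    case False
    have "\<Inter>(?C ` I) \<noteq> {}"
    proof (rule compact[unfolded compact_space_fip, rule_format], intro conjI allI impI ballI)
      fix C assume "C \<in> ?C ` I" then show "closedin ?X C" using closed by auto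
    next
      fix \<F> assume "finite \<F> \<and> \<F> \<subseteq> ?C ` I"
      then obtain J where J: "finite J" "J \<subseteq> I" "\<F> = ?C ` J"
        by (meson finite_subset_image)
      from sat[OF J(1,2)] obtain f where f: "f ` V \<subseteq> Y" "\<forall>j\<in>J. P j f" by auto
      \<comment> \<open>Points of the product space are extensional functions; restricting keeps the
        constraint since \<open>D j\<close> lies in \<open>V\<close>.\<close>
      have "restrict f V \<in> ?C j" if "j \<in> J" for j
      proof -
        have "j \<in> I" "D j \<subseteq> V" using J(2) that fin by auto
        then have "P j (restrict f V)"
          by (intro dep[of j f "restrict f V"]) (use that f(2) in auto)
        then show ?thesis using f by auto
      qed
      then show "\<Inter>\<F> \<noteq> {}" using J(3) by blast
    qed
    then obtain f where f: "\<And>i. i \<in> I \<Longrightarrow> f \<in> ?C i" by auto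
    with False have "f ` V \<subseteq> Y" by (auto simp: PiE_iff)
    with f show ?thesis by auto
  qed
qed

text \<open>Only the vertex map requires a simultaneous choice. An arc merely demands that some arc
  of \<open>F\<close> fits its ends and label, and once the vertex map is fixed these arcs are
  chosen independently. Hence finitely many vertices of \<open>F\<close> suffice.\<close>

lemma lgraph_homs_if_weakly_maps:
  assumes wG: "wf_digraph (gr G)" and wF: "wf_digraph (gr F)" and fin: "finite (verts (gr F))"
    and weak: "weakly_maps G F"
  shows "lgraph_homs G F \<noteq> {}"
proof -
  let ?V = "verts (gr G)" and ?E = "arcs (gr G)" and ?t = "tail (gr G)" and ?h = "head (gr G)"
  define compat where "compat f e \<longleftrightarrow> (\<exists>a\<in>arcs (gr F). elab F a = elab G e
      \<and> tail (gr F) a = f (?t e) \<and> head (gr F) a = f (?h e))" for f :: "'a \<Rightarrow> 'e" and e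
  define P where "P = case_sum (\<lambda>v f. vlab F (f v) = vlab G v) (\<lambda>e f. compat f e)"
  have sub: "\<exists>f. f ` W \<subseteq> verts (gr F) \<and> (\<forall>v\<in>W. vlab F (f v) = vlab G v) \<and> (\<forall>e\<in>E. compat f e)"
    if fs: "finite W" "finite E" "W \<subseteq> ?V" "E \<subseteq> ?E" "?t ` E \<subseteq> W" "?h ` E \<subseteq> W" for W E
  proof -
    let ?K = "\<lparr>verts = W, arcs = E, tail = ?t, head = ?h\<rparr>"
    have wK: "wf_digraph ?K" using fs by (intro wf_digraph.intro) auto
    then have "fin_digraph ?K" using fs(1,2) by (intro fin_digraph.intro fin_digraph_axioms.intro) auto
    moreover have "subgraph ?K (gr G)" using wK wG fs by (simp add: subgraph_def compatible_def)
    ultimately have "lgraph_homs (G\<lparr>gr := ?K\<rparr>) F \<noteq> {}"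
      using weak unfolding weakly_maps_def by blast
    then obtain f g where "(f, g) \<in> lgraph_homs (G\<lparr>gr := ?K\<rparr>) F" by auto
    then have "f ` W \<subseteq> verts (gr F)" "\<forall>v\<in>W. vlab F (f v) = vlab G v" "\<forall>e\<in>E. compat f e"
      by (auto simp: lgraph_homs_def graph_hom_def compat_def)
    then show ?thesis by blast
  qed
  have "\<exists>f. f ` ?V \<subseteq> verts (gr F) \<and> (\<forall>i\<in>?V <+> ?E. P i f)"
  proof (rule compactness_finite_choices[OF fin, where D = "case_sum (\<lambda>v. {v}) (\<lambda>e. {?t e, ?h e})"])
    fix i assume "i \<in> ?V <+> ?E"
    then show "finite (case_sum (\<lambda>v. {v}) (\<lambda>e. {?t e, ?h e}) i)
        \<and> case_sum (\<lambda>v. {v}) (\<lambda>e. {?t e, ?h e}) i \<subseteq> ?V"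
      using wG by (auto simp: wf_digraph_def)
  next
    fix i f f' assume "\<And>v. v \<in> case_sum (\<lambda>v. {v}) (\<lambda>e. {?t e, ?h e}) i \<Longrightarrow> f v = f' v" "P i f"
    then show "P i f'" by (cases i) (auto simp: P_def compat_def)
  next
    fix J assume J: "finite J" "J \<subseteq> ?V <+> ?E"
    show "\<exists>f. f ` ?V \<subseteq> verts (gr F) \<and> (\<forall>j\<in>J. P j f)"
    proof (cases "?V = {}")
      case True
      then have "J = {}" using J(2) wG by (auto simp: wf_digraph_def)
      with True show ?thesis by auto
    next
      case False
      then obtain v0 where "v0 \<in> ?V" by auto
      \<comment> \<open>A default value outside the finite subgraph; it exists since the subgraph
        with the single vertex \<open>v0\<close> maps to \<open>F\<close>.\<close>
      then obtain y0 where y0: "y0 \<in> verts (gr F)" using sub[of "{v0}" "{}"] by auto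
      define E where "E = Inr -` J"
      define W where "W = Inl -` J \<union> ?t ` E \<union> ?h ` E"
      have E: "finite E" "E \<subseteq> ?E" using J by (auto simp: E_def intro!: finite_vimageI)
      have W: "finite W" "W \<subseteq> ?V" using J E wG by (auto simp: W_def wf_digraph_def intro!: finite_vimageI)
      have ends: "?t ` E \<subseteq> W" "?h ` E \<subseteq> W" by (auto simp: W_def)
      obtain f where f: "f ` W \<subseteq> verts (gr F)" "\<forall>v\<in>W. vlab F (f v) = vlab G v" "\<forall>e\<in>E. compat f e"
        using sub[OF W(1) E(1) W(2) E(2) ends] by blast
      let ?f = "\<lambda>v. if v \<in> W then f v else y0"
      have "P j ?f" if "j \<in> J" for j
      proof (cases j)
        case (Inl v)
        then have "v \<in> W" using that by (simp add: W_def)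
        then show ?thesis using f(2) Inl by (simp add: P_def)
      next
        case (Inr e)
        then have "e \<in> E" using that by (simp add: E_def)
        moreover from this have "?t e \<in> W" "?h e \<in> W" using ends by auto
        ultimately show ?thesis using f(3) Inr by (simp add: P_def compat_def)
      qed
      moreover have "?f ` ?V \<subseteq> verts (gr F)" using f(1) y0 by auto
      ultimately show ?thesis by blast
    qed
  qed
  then obtain f where f: "f ` ?V \<subseteq> verts (gr F)" and P: "\<And>i. i \<in> ?V <+> ?E \<Longrightarrow> P i f"
    by auto
  have v: "vlab F (f v) = vlab G v" if "v \<in> ?V" for v
    using P[OF InlI[OF that]] by (simp add: P_def)
  have e: "compat f e" if "e \<in> ?E" for e
    using P[OF InrI[OF that]] by (simp add: P_def)
  have "\<forall>e\<in>?E. \<exists>a. a \<in> arcs (gr F) \<and> elab F a = elab G e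
      \<and> tail (gr F) a = f (?t e) \<and> head (gr F) a = f (?h e)"
    using e unfolding compat_def by blast
  then obtain g where "\<forall>e\<in>?E. g e \<in> arcs (gr F) \<and> elab F (g e) = elab G e
      \<and> tail (gr F) (g e) = f (?t e) \<and> head (gr F) (g e) = f (?h e)"
    by (rule bchoice[THEN exE])
  with f v wG wF have "(f, g) \<in> lgraph_homs G F"
    by (auto simp: lgraph_homs_def graph_hom_def)
  then show ?thesis by auto
qed

lemma weakly_maps_trans_homs:
  assumes "weakly_maps G H" and hom: "lgraph_homs H F \<noteq> {}"
  shows "weakly_maps G F"
  unfolding weakly_maps_def
proof (intro allI impI)
  fix K assume "subgraph K (gr G) \<and> fin_digraph K"
  then have "lgraph_homs (G\<lparr>gr := K\<rparr>) H \<noteq> {}"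
    using assms(1) unfolding weakly_maps_def by blast
  then obtain f g where fg: "(f, g) \<in> lgraph_homs (G\<lparr>gr := K\<rparr>) H" by auto
  obtain f' g' where fg': "(f', g') \<in> lgraph_homs H F" using hom by auto
  from fg fg' have "(f' \<circ> f, g' \<circ> g) \<in> lgraph_homs (G\<lparr>gr := K\<rparr>) F"
    by (simp add: lgraph_homs_def graph_hom_def)
  then show "lgraph_homs (G\<lparr>gr := K\<rparr>) F \<noteq> {}" by auto
qed

lemma lgraph_homs_if_weakly_maps_trans:
  assumes "labelled B G" "labelled B F" "standard_lgraph F" "weakly_maps G H" "lgraph_homs H F \<noteq> {}"
  shows "lgraph_homs G F \<noteq> {}"
proof (rule lgraph_homs_if_weakly_maps)
  show "wf_digraph (gr G)" "wf_digraph (gr F)" using assms by (auto simp: labelled_def graph_hom_def)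
  show "finite (verts (gr F))" using assms(3) by (auto simp: standard_lgraph_def)
  show "weakly_maps G F" using assms(4,5) by (rule weakly_maps_trans_homs)
qed

section \<open>State assignments\<close>

text \<open>
  A vertex over a vertex of \<open>B\<close> has as state its image in \<open>F\<close>. A vertex inside the subdivision of an
  arc has state \<open>a + 2\<close> if it lies on coherent paths, which are then mapped to the arc \<open>a\<close> of \<open>F\<close>,
  and otherwise state 0 if no coherent path can be completed from it and state 1 if none leads to it.
\<close>

fun vertex_state :: "(nat, nat, 'c, 'd) lgraph \<Rightarrow> 'c + 'd \<Rightarrow> nat \<Rightarrow> bool" where
  "vertex_state F (Inl b) y \<longleftrightarrow> y \<in> verts (gr F) \<and> vlab F y = b"
| "vertex_state F (Inr d) y \<longleftrightarrow> y < 2 \<or> y - 2 \<in> arcs (gr F) \<and> elab F (y - 2) = d"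

text \<open>Along interior arcs 0 can only be followed by 0, only 1 can precede 1, and an arc of
  \<open>F\<close> persists or drops to 0. No first arc enters a 1 and no last arc leaves a
  0.\<close>

fun arc_state :: "(nat, nat, 'c, 'd) lgraph \<Rightarrow> bool \<times> 'd \<times> bool \<Rightarrow> nat \<Rightarrow> nat \<Rightarrow> bool" where
  "arc_state F (False, d, False) y y' \<longleftrightarrow>
     (\<exists>a\<in>arcs (gr F). elab F a = d \<and> tail (gr F) a = y \<and> head (gr F) a = y')"
| "arc_state F (False, d, True) y y' \<longleftrightarrow>
     y' = 0 \<or> 2 \<le> y' \<and> y' - 2 \<in> arcs (gr F) \<and> tail (gr F) (y' - 2) = y"
| "arc_state F (True, d, True) y y' \<longleftrightarrow> y' = 0 \<or> y = 1 \<or> y = y'"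
| "arc_state F (True, d, False) y y' \<longleftrightarrow>
     y = 1 \<or> 2 \<le> y \<and> y - 2 \<in> arcs (gr F) \<and> head (gr F) (y - 2) = y'"

definition state_assignment ::
  "('v, 'e, 'c + 'd, bool \<times> 'd \<times> bool) lgraph \<Rightarrow> (nat, nat, 'c, 'd) lgraph \<Rightarrow> ('v \<Rightarrow> nat) \<Rightarrow> bool" where
  "state_assignment K F st \<longleftrightarrow> (\<forall>v\<in>verts (gr K). vertex_state F (vlab K v) (st v))
     \<and> (\<forall>e\<in>arcs (gr K). arc_state F (elab K e) (st (tail (gr K) e)) (st (head (gr K) e)))"

text \<open>Labels of coherent paths are prescribed position by position; this puts the incidence
  condition into the same form, fit for induction on positions.\<close>

lemma cas_iff_nth:
  "p \<noteq> [] \<Longrightarrow> pre_digraph.cas G (tail G (hd p)) p (head G (last p))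
     \<longleftrightarrow> (\<forall>i. Suc i < length p \<longrightarrow> head G (p ! i) = tail G (p ! Suc i))"
proof (induction p)
  case (Cons e p)
  show ?case
  proof (cases p)
    case Nil
    then show ?thesis by (simp add: pre_digraph.cas.simps)
  next
    case (Cons e' q)
    have "(\<forall>i. Suc i < length (e # p) \<longrightarrow> head G ((e # p) ! i) = tail G ((e # p) ! Suc i))
        \<longleftrightarrow> head G e = tail G e' \<and> (\<forall>i. Suc i < length p \<longrightarrow> head G (p ! i) = tail G (p ! Suc i))"
      unfolding Cons by (auto simp: less_Suc_eq_0_disj nth_Cons split: nat.splits)
    moreover have "pre_digraph.cas G (tail G (hd (e # p))) (e # p) (head G (last (e # p)))
        \<longleftrightarrow> head G e = tail G e' \<and> pre_digraph.cas G (tail G (hd p)) p (head G (last p))"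
      unfolding Cons by (auto simp: pre_digraph.cas.simps)
    ultimately show ?thesis using Cons.IH Cons by simp
  qed
qed simp

lemma coherent_path_iff:
  assumes "wf_digraph (gr K)"
  shows "coherent_path K c p \<longleftrightarrow> p \<noteq> [] \<and> set p \<subseteq> arcs (gr K)
     \<and> (\<forall>i. Suc i < length p \<longrightarrow> head (gr K) (p ! i) = tail (gr K) (p ! Suc i))
     \<and> (\<forall>i < length p. elab K (p ! i) = (i \<noteq> 0, c, Suc i \<noteq> length p))"
proof (cases "p = []")
  case False
  have "tail (gr K) (hd p) \<in> verts (gr K)" if "set p \<subseteq> arcs (gr K)"
    using that False assms by (metis hd_in_set subsetD wf_digraph.tail_in_verts)
  then show ?thesis
    using False by (auto simp: coherent_path_def pre_digraph.awalk_def cas_iff_nth)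
qed (simp add: coherent_path_def)

section \<open>From state assignments to morphisms\<close>

lemma coherent_path_unique:
  assumes "coherent_path K c p" "coherent_path K c' p" shows "c = c'"
  using assms by (auto simp: coherent_path_def)

lemma elab_flat: "coherent_path K c p \<Longrightarrow> elab (flat K) p = c"
  by (auto simp: flat_def intro: coherent_path_unique)

lemma path_subdivision_labels:
  assumes "graph_hom (gr K) (path_subdivision B) (vlab K) (elab K)"
    and "e \<in> arcs (gr K)" "elab K e = (i, c, j)"
  shows "vlab K (tail (gr K) e) = (if i then Inr c else Inl (tail B c))"
    "vlab K (head (gr K) e) = (if j then Inr c else Inl (head B c))"
  using assms by (auto simp: graph_hom_def path_subdivision_def dest!: bspec)

lemma state_assignment_coherent_path:
  assumes K: "graph_hom (gr K) (path_subdivision B) (vlab K) (elab K)"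
    and st: "state_assignment K F st" and p: "coherent_path K c p"
  shows "\<exists>a\<in>arcs (gr F). elab F a = c \<and> tail (gr F) a = st (tail (gr K) (hd p))
    \<and> head (gr F) a = st (head (gr K) (last p))"
proof -
  have wK: "wf_digraph (gr K)" using K by (simp add: graph_hom_def)
  have ne: "p \<noteq> []" and sub: "set p \<subseteq> arcs (gr K)"
    and link: "\<And>i. Suc i < length p \<Longrightarrow> head (gr K) (p ! i) = tail (gr K) (p ! Suc i)"
    and lab: "\<And>i. i < length p \<Longrightarrow> elab K (p ! i) = (i \<noteq> 0, c, Suc i \<noteq> length p)"
    using p unfolding coherent_path_iff[OF wK] by auto
  have arc: "arc_state F (elab K (p ! i)) (st (tail (gr K) (p ! i))) (st (head (gr K) (p ! i)))"
    if "i < length p" for i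
    using st subsetD[OF sub nth_mem[OF that]] by (simp add: state_assignment_def)
  show ?thesis
  proof (cases "length p = 1")
    case True
    then obtain e where "p = [e]" by (auto simp: length_Suc_conv)
    then show ?thesis using arc[of 0] lab[of 0] by auto
  next
    case False
    then obtain n where n: "length p = Suc (Suc n)"
      using ne by (metis One_nat_def length_0_conv not0_implies_Suc)
    \<comment> \<open>State 1 cannot be entered from a first arc, nor later from a state other than
      1. State 0 remains possible until the last arc rules it out.\<close>
    have inv: "st (head (gr K) (p ! i)) = 0 \<or> 2 \<le> st (head (gr K) (p ! i))
        \<and> tail (gr F) (st (head (gr K) (p ! i)) - 2) = st (tail (gr K) (hd p))" if "i \<le> n" for i
      using that
    proof (induction i)
      case 0
      then show ?case using arc[of 0] lab[of 0] n ne by (auto simp: hd_conv_nth)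
    next
      case (Suc i)
      then show ?case using arc[of "Suc i"] lab[of "Suc i"] link[of i] n by auto
    qed
    have last: "last p = p ! Suc n" using ne n by (simp add: last_conv_nth)
    have hin: "p ! n \<in> arcs (gr K)" "p ! Suc n \<in> arcs (gr K)" using sub n by (auto simp: subset_iff)
    define y where "y = st (tail (gr K) (p ! Suc n))"
    have "vlab K (tail (gr K) (p ! Suc n)) = Inr c"
      using path_subdivision_labels(1)[OF K hin(2) lab] n by simp
    moreover have "tail (gr K) (p ! Suc n) \<in> verts (gr K)"
      using wK hin(2) by (simp add: wf_digraph_def)
    \<comment> \<open>The invariant controls only the tail. That the state names an arc of
      \<open>F\<close> with label \<open>c\<close> comes from the condition at the last inner
      vertex.\<close>
    ultimately have v: "vertex_state F (Inr c) y"
      using st unfolding state_assignment_def y_def by metis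
    have a: "arc_state F (True, c, False) y (st (head (gr K) (last p)))"
      using arc[of "Suc n"] lab[of "Suc n"] n by (simp add: last y_def)
    have i: "y = 0 \<or> 2 \<le> y \<and> tail (gr F) (y - 2) = st (tail (gr K) (hd p))"
      using inv[of n] link[of n] n by (simp add: y_def)
    have "2 \<le> y" using a i by auto
    then have "y - 2 \<in> arcs (gr F)" "elab F (y - 2) = c" "tail (gr F) (y - 2) = st (tail (gr K) (hd p))"
      "head (gr F) (y - 2) = st (head (gr K) (last p))"
      using v a i by simp_all
    then show ?thesis by blast
  qed
qed

lemma flat_homs_if_state_assignment:
  assumes K: "graph_hom (gr K) (path_subdivision B) (vlab K) (elab K)"
    and "wf_digraph (gr (flat K))" and "wf_digraph (gr F)" and st: "state_assignment K F st"
  shows "lgraph_homs (flat K) F \<noteq> {}"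
proof -
  have "\<exists>a\<in>arcs (gr F). elab F a = elab (flat K) p \<and> tail (gr F) a = st (tail (gr (flat K)) p)
      \<and> head (gr F) a = st (head (gr (flat K)) p)" if "p \<in> arcs (gr (flat K))" for p
  proof -
    from that obtain c where "coherent_path K c p" by (auto simp: flat_def)
    from state_assignment_coherent_path[OF K st this] elab_flat[OF this] show ?thesis
      by (auto simp: flat_def)
  qed
  then obtain g where "\<forall>p\<in>arcs (gr (flat K)). g p \<in> arcs (gr F) \<and> elab F (g p) = elab (flat K) p
      \<and> tail (gr F) (g p) = st (tail (gr (flat K)) p) \<and> head (gr F) (g p) = st (head (gr (flat K)) p)"
    by metis
  moreover have "st v \<in> verts (gr F) \<and> vlab F (st v) = vlab (flat K) v"
    if v: "v \<in> verts (gr (flat K))" for v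
  proof -
    have "v \<in> verts (gr K)" "isl (vlab K v)" using v by (auto simp: flat_def)
    then have "vertex_state F (vlab K v) (st v)" "vlab K v = Inl (vlab (flat K) v)"
      using st by (auto simp: state_assignment_def flat_def)
    then show ?thesis by simp
  qed
  ultimately have "(st, g) \<in> lgraph_homs (flat K) F"
    using assms(2,3) by (auto simp: lgraph_homs_def graph_hom_def)
  then show ?thesis by auto
qed

section \<open>From morphisms to state assignments\<close>

inductive reach_from :: "('v, 'e, 'c + 'd, bool \<times> 'd \<times> bool) lgraph \<Rightarrow> 'd \<Rightarrow> 'v \<Rightarrow> 'v \<Rightarrow> bool"
  for K c where
  start: "e \<in> arcs (gr K) \<Longrightarrow> elab K e = (False, c, True) \<Longrightarrow>
    reach_from K c (tail (gr K) e) (head (gr K) e)"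
| step: "reach_from K c a (tail (gr K) e) \<Longrightarrow> e \<in> arcs (gr K) \<Longrightarrow> elab K e = (True, c, True) \<Longrightarrow>
    reach_from K c a (head (gr K) e)"

text \<open>Together with \<open>reach_from\<close> this cuts coherent paths at an inner vertex and
  keeps only the ends of the pieces, so that pieces of different paths can be recombined.\<close>

inductive reach_to :: "('v, 'e, 'c + 'd, bool \<times> 'd \<times> bool) lgraph \<Rightarrow> 'd \<Rightarrow> 'v \<Rightarrow> 'v \<Rightarrow> bool"
  for K c where
  stop: "e \<in> arcs (gr K) \<Longrightarrow> elab K e = (True, c, False) \<Longrightarrow>
    reach_to K c (tail (gr K) e) (head (gr K) e)"
| step: "reach_to K c (head (gr K) e) b \<Longrightarrow> e \<in> arcs (gr K) \<Longrightarrow> elab K e = (True, c, True) \<Longrightarrow>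
    reach_to K c (tail (gr K) e) b"

lemma coherent_path_if_reach:
  assumes wK: "wf_digraph (gr K)" and "reach_from K c a v" "reach_to K c v b"
  shows "\<exists>p. coherent_path K c p \<and> tail (gr K) (hd p) = a \<and> head (gr K) (last p) = b"
proof -
  \<comment> \<open>With \<open>i0\<close> false this is a coherent path, with \<open>i0\<close>
    true a final piece of one. The final piece is built first and then extended backwards to the
    start.\<close>
  define walk where "walk i0 b q \<longleftrightarrow> q \<noteq> [] \<and> set q \<subseteq> arcs (gr K) \<and> head (gr K) (last q) = b
     \<and> (\<forall>i. Suc i < length q \<longrightarrow> head (gr K) (q ! i) = tail (gr K) (q ! Suc i))
     \<and> (\<forall>i < length q. elab K (q ! i) = (i0 \<or> i \<noteq> 0, c, Suc i \<noteq> length q))" for i0 b q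
  have cons: "walk i0 b (e # q)" if "walk True b q" "e \<in> arcs (gr K)" "elab K e = (i0, c, True)"
    "head (gr K) e = tail (gr K) (hd q)" for e q i0 b
    using that unfolding walk_def
    by (auto simp: nth_Cons hd_conv_nth split: nat.splits)
  have "\<exists>q. walk True b q \<and> tail (gr K) (hd q) = v"
    using assms(3)
  proof (induction rule: reach_to.induct)
    case (stop e)
    then have "walk True (head (gr K) e) [e]" by (simp add: walk_def)
    then show ?case by (intro exI[of _ "[e]"]) simp
  next
    case (step e b)
    then show ?case using cons[of b _ e True] by (metis list.sel(1))
  qed
  then obtain q where q: "walk True b q" "tail (gr K) (hd q) = v" by auto
  have "\<exists>p. walk False b p \<and> tail (gr K) (hd p) = a" using assms(2) q
  proof (induction arbitrary: q rule: reach_from.induct)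
    case (start e)
    then show ?case using cons[of b q e False] by (intro exI[of _ "e # q"]) auto
  next
    case (step a e)
    then show ?case using cons[of b q e True] by (metis list.sel(1))
  qed
  then show ?thesis using wK by (auto simp: walk_def coherent_path_iff)
qed

text \<open>A morphism from \<open>flat K\<close> acts on whole paths, whereas states live at single
  vertices. The transfer works because the ends of a coherent path are determined by
  \<open>c\<close> and any one of its inner vertices.\<close>

lemma state_assignment_if_flat_homs:
  assumes K: "graph_hom (gr K) (path_subdivision B) (vlab K) (elab K)"
    and etale: "weakly_etale (flat K)" and hom: "lgraph_homs (flat K) F \<noteq> {}"
  shows "\<exists>st. state_assignment K F st"
proof -
  have wK: "wf_digraph (gr K)" using K by (simp add: graph_hom_def)
  obtain f g where fg: "(f, g) \<in> lgraph_homs (flat K) F" using hom by auto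
  define joins where "joins c a b p \<longleftrightarrow> coherent_path K c p \<and> tail (gr K) (hd p) = a \<and> head (gr K) (last p) = b"
    for c a b p
  define through where "through c v x \<longleftrightarrow> reach_from K c (fst x) v \<and> reach_to K c v (snd x)" for c v x
  \<comment> \<open>Coherent paths with the same ends may go to different parallel arcs of
    \<open>F\<close>. Selecting one path per pair of ends makes neighbouring inner vertices
    agree.\<close>
  define arc where "arc c x = g (SOME p. joins c (fst x) (snd x) p)" for c x
  \<comment> \<open>Off the coherent paths, a vertex that can be completed gets 1 and every other
    one 0, even if no start leads to it.\<close>
  define st where "st v = (case vlab K v of Inl _ \<Rightarrow> f v | Inr c \<Rightarrow>
     if \<exists>x. through c v x then 2 + arc c (SOME x. through c v x)
     else if \<exists>b. reach_to K c v b then 1 else 0)" for v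
  have garc: "g p \<in> arcs (gr F) \<and> elab F (g p) = c \<and> tail (gr F) (g p) = f a \<and> head (gr F) (g p) = f b"
    if "joins c a b p" for c a b p
  proof -
    have "p \<in> arcs (gr (flat K))" "elab (flat K) p = c" "tail (gr (flat K)) p = a" "head (gr (flat K)) p = b"
      using that elab_flat[of K c p] by (auto simp: joins_def flat_def)
    then show ?thesis using fg by (auto simp: lgraph_homs_def graph_hom_def)
  qed
  have unique: "a = a' \<and> b = b'" if "joins c a b p" "joins c a' b' p'" "a = a' \<or> b = b'" for c a b a' b' p p'
  proof -
    have "p \<in> arcs (gr (flat K))" "p' \<in> arcs (gr (flat K))"
      using that(1,2) by (auto simp: joins_def flat_def)
    moreover have "elab (flat K) p = elab (flat K) p'"
      using elab_flat[of K c p] elab_flat[of K c p'] that(1,2) by (simp add: joins_def)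
    ultimately have "(tail (gr (flat K)) p = tail (gr (flat K)) p' \<or> head (gr (flat K)) p = head (gr (flat K)) p')
        \<longrightarrow> (tail (gr (flat K)) p = tail (gr (flat K)) p' \<and> head (gr (flat K)) p = head (gr (flat K)) p')"
      using etale unfolding weakly_etale_def by blast
    then show ?thesis using that by (simp add: joins_def flat_def) blast
  qed
  have joined: "\<exists>p. joins c (fst x) (snd x) p" if "through c v x" for c v x
    using coherent_path_if_reach[OF wK] that by (auto simp: through_def joins_def)
  \<comment> \<open>Crossing two coherent paths through \<open>v\<close> yields a third one, which shares its tail with one of
    them and its head with the other; hence weak etaleness forces all ends to agree.\<close>
  have through_unique: "x = y" if x: "through c v x" and y: "through c v y" for c v x y
  proof -
    have xy: "through c v (fst x, snd y)" using x y by (simp add: through_def)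
    obtain p q r where "joins c (fst x) (snd x) p" "joins c (fst x) (snd y) q" "joins c (fst y) (snd y) r"
      using joined[OF x] joined[OF xy] joined[OF y] by auto
    then show ?thesis using unique by (metis prod_eqI)
  qed
  have arc: "arc c x \<in> arcs (gr F) \<and> elab F (arc c x) = c \<and> tail (gr F) (arc c x) = f (fst x)
      \<and> head (gr F) (arc c x) = f (snd x)" if "through c v x" for c v x
    unfolding arc_def by (rule garc) (rule someI_ex[OF joined[OF that]])
  have st_through: "st v = 2 + arc c x" if "vlab K v = Inr c" "through c v x" for v c x
  proof -
    have "(SOME x. through c v x) = x" using that(2) through_unique by blast
    moreover have "\<exists>x. through c v x" using that(2) by blast
    ultimately show ?thesis using that(1) by (simp add: st_def del: split_paired_Ex)
  qed
  have st_Inl: "st v = f v" if "vlab K v = Inl b" for v b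
    using that by (simp add: st_def)
  have st_to: "st v = 1" if "vlab K v = Inr c" "reach_to K c v b" "\<nexists>a. reach_from K c a v" for v c b
    using that by (auto simp: st_def through_def)
  have st_0: "st v = 0" if "vlab K v = Inr c" "\<nexists>b. reach_to K c v b" for v c
    using that by (auto simp: st_def through_def)
  have "vertex_state F (vlab K v) (st v)" if v: "v \<in> verts (gr K)" for v
  proof (cases "vlab K v")
    case (Inl b)
    then have "v \<in> verts (gr (flat K))" "vlab (flat K) v = b" using v by (auto simp: flat_def)
    then show ?thesis using fg Inl st_Inl by (auto simp: lgraph_homs_def graph_hom_def)
  next
    case (Inr c)
    show ?thesis
    proof (cases "\<exists>x. through c v x")
      case True
      then obtain x where "through c v x" by blast
      from arc[OF this] st_through[OF Inr this] show ?thesis using Inr by simp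
    next
      case False
      then have "st v = (if \<exists>b. reach_to K c v b then 1 else 0)"
        by (simp only: st_def Inr sum.case if_False)
      then show ?thesis by (simp add: Inr)
    qed
  qed
  moreover have "arc_state F (elab K e) (st (tail (gr K) e)) (st (head (gr K) e))"
    if e: "e \<in> arcs (gr K)" for e
  proof -
    let ?u = "tail (gr K) e" and ?w = "head (gr K) e"
    obtain i c j where l: "elab K e = (i, c, j)" by (cases "elab K e") auto
    note lab = path_subdivision_labels[OF K e l]
    consider "\<not> i" "\<not> j" | "\<not> i" j | i j | i "\<not> j" by blast
    then show ?thesis
    proof cases
      case 1
      then have "joins c ?u ?w [e]" using l e by (simp add: joins_def coherent_path_iff[OF wK])
      from garc[OF this] show ?thesis using 1 l lab st_Inl by auto
    next
      case 2
      then have reach: "reach_from K c ?u ?w" using reach_from.start[OF e] l by auto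
      have w: "vlab K ?w = Inr c" and u: "st ?u = f ?u" using lab 2 st_Inl by auto
      show ?thesis
      proof (cases "\<exists>b. reach_to K c ?w b")
        case True
        then obtain b where "through c ?w (?u, b)" using reach by (auto simp: through_def)
        with arc[OF this] st_through[OF w this] u show ?thesis using 2 l by auto
      qed (use 2 l st_0[OF w] in auto)
    next
      case 3
      have w: "vlab K ?w = Inr c" and u: "vlab K ?u = Inr c" using lab 3 by auto
      \<comment> \<open>If the head has no completion its state is 0; if no start leads to the tail,
        the state of the tail is 1; otherwise one pair of ends passes through both.\<close>
      show ?thesis
      proof (cases "\<exists>b. reach_to K c ?w b")
        case True
        then obtain b where b: "reach_to K c ?w b" by auto
        then have to: "reach_to K c ?u b" using reach_to.step[OF b e] 3 l by auto
        show ?thesis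
        proof (cases "\<exists>a. reach_from K c a ?u")
          case True
          then obtain a where a: "reach_from K c a ?u" by auto
          then have "reach_from K c a ?w" using reach_from.step[OF a e] 3 l by auto
          then have "through c ?w (a, b)" "through c ?u (a, b)" using a b to by (auto simp: through_def)
          then show ?thesis using st_through[OF w] st_through[OF u] 3 l by simp
        qed (use 3 l st_to[OF u to] in auto)
      qed (use 3 l st_0[OF w] in auto)
    next
      case 4
      then have to: "reach_to K c ?u ?w" using reach_to.stop[OF e] l by auto
      have u: "vlab K ?u = Inr c" and w: "st ?w = f ?w" using lab 4 st_Inl by auto
      show ?thesis
      proof (cases "\<exists>a. reach_from K c a ?u")
        case True
        then obtain a where "through c ?u (a, ?w)" using to by (auto simp: through_def)
        with arc[OF this] st_through[OF u this] w show ?thesis using 4 l by auto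
      qed (use 4 l st_to[OF u to] in auto)
    qed
  qed
  ultimately show ?thesis by (auto simp: state_assignment_def)
qed

section \<open>The target graph\<close>

definition code_nverts :: "nat \<Rightarrow> nat" where
  "code_nverts c = length (list_decode (fst (prod_decode c)))"

definition code_narcs :: "nat \<Rightarrow> nat" where
  "code_narcs c = length (list_decode (snd (prod_decode c)))"

definition code_vlab :: "nat \<Rightarrow> nat \<Rightarrow> nat" where
  "code_vlab c v = list_code_nth (fst (prod_decode c)) v"

definition code_tail :: "nat \<Rightarrow> nat \<Rightarrow> nat" where
  "code_tail c e = fst (prod_decode (list_code_nth (snd (prod_decode c)) e))"

definition code_head :: "nat \<Rightarrow> nat \<Rightarrow> nat" where
  "code_head c e = fst (prod_decode (snd (prod_decode (list_code_nth (snd (prod_decode c)) e))))"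

definition code_elab :: "nat \<Rightarrow> nat \<Rightarrow> nat" where
  "code_elab c e = snd (prod_decode (snd (prod_decode (list_code_nth (snd (prod_decode c)) e))))"

lemmas code_defs = code_nverts_def code_narcs_def code_vlab_def code_tail_def code_head_def code_elab_def

lemma rec_in_code [rec_intros]:
  assumes "rec_in vs f"
  shows "rec_in vs (\<lambda>x. code_nverts (f x))" "rec_in vs (\<lambda>x. code_narcs (f x))"
    "rec_in vs i \<Longrightarrow> rec_in vs (\<lambda>x. code_vlab (f x) (i x))"
    "rec_in vs i \<Longrightarrow> rec_in vs (\<lambda>x. code_tail (f x) (i x))"
    "rec_in vs i \<Longrightarrow> rec_in vs (\<lambda>x. code_head (f x) (i x))"
    "rec_in vs i \<Longrightarrow> rec_in vs (\<lambda>x. code_elab (f x) (i x))"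
  unfolding code_defs by (intro rec_intros assms; assumption)+

lemma code_lgraph_standard:
  assumes "standard_lgraph F"
  shows "v < code_nverts (code_lgraph \<nu> \<epsilon> F) \<longleftrightarrow> v \<in> verts (gr F)"
    "e < code_narcs (code_lgraph \<nu> \<epsilon> F) \<longleftrightarrow> e \<in> arcs (gr F)"
    "v \<in> verts (gr F) \<Longrightarrow> code_vlab (code_lgraph \<nu> \<epsilon> F) v = \<nu> (vlab F v)"
    "e \<in> arcs (gr F) \<Longrightarrow> code_tail (code_lgraph \<nu> \<epsilon> F) e = tail (gr F) e"
    "e \<in> arcs (gr F) \<Longrightarrow> code_head (code_lgraph \<nu> \<epsilon> F) e = head (gr F) e"
    "e \<in> arcs (gr F) \<Longrightarrow> code_elab (code_lgraph \<nu> \<epsilon> F) e = \<epsilon> (elab F e)"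
  using assms by (auto simp: standard_lgraph_def code_lgraph_def code_defs)

section \<open>The state conditions in terms of codes\<close>

fun code_vertex_state :: "('c \<Rightarrow> nat) \<Rightarrow> ('d \<Rightarrow> nat) \<Rightarrow> nat \<Rightarrow> 'c + 'd \<Rightarrow> nat \<Rightarrow> bool" where
  "code_vertex_state \<nu> \<epsilon> c (Inl b) y \<longleftrightarrow> y < code_nverts c \<and> code_vlab c y = \<nu> b"
| "code_vertex_state \<nu> \<epsilon> c (Inr d) y \<longleftrightarrow>
     y < 2 \<or> y - 2 < code_narcs c \<and> code_elab c (y - 2) = \<epsilon> d"

fun code_arc_state :: "('d \<Rightarrow> nat) \<Rightarrow> nat \<Rightarrow> bool \<times> 'd \<times> bool \<Rightarrow> nat \<Rightarrow> nat \<Rightarrow> bool" where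
  "code_arc_state \<epsilon> c (False, d, False) y y' \<longleftrightarrow>
     (\<exists>a<code_narcs c. code_elab c a = \<epsilon> d \<and> code_tail c a = y \<and> code_head c a = y')"
| "code_arc_state \<epsilon> c (False, d, True) y y' \<longleftrightarrow>
     y' = 0 \<or> 2 \<le> y' \<and> y' - 2 < code_narcs c \<and> code_tail c (y' - 2) = y"
| "code_arc_state \<epsilon> c (True, d, True) y y' \<longleftrightarrow> y' = 0 \<or> y = 1 \<or> y = y'"
| "code_arc_state \<epsilon> c (True, d, False) y y' \<longleftrightarrow>
     y = 1 \<or> 2 \<le> y \<and> y - 2 < code_narcs c \<and> code_head c (y - 2) = y'"

lemma dec_in_code_vertex_state [rec_intros]:
  assumes "rec_in vs f" "rec_in vs y"
  shows "dec_in vs (\<lambda>x. code_vertex_state \<nu> \<epsilon> (f x) l (y x))"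
proof (cases l)
  case (Inl b)
  show ?thesis unfolding Inl code_vertex_state.simps by (intro rec_intros assms)
next
  case (Inr d)
  show ?thesis unfolding Inr code_vertex_state.simps by (intro rec_intros assms)
qed

lemma dec_in_code_arc_state [rec_intros]:
  assumes "rec_in vs f" "rec_in vs y" "rec_in vs y'"
  shows "dec_in vs (\<lambda>x. code_arc_state \<epsilon> (f x) l (y x) (y' x))"
proof -
  obtain i d j where l: "l = (i, d, j)" by (cases l) auto
  show ?thesis
    by (cases i; cases j; simp only: l code_arc_state.simps; intro rec_intros rec_in_weaken assms)
qed

text \<open>Equal numbers mean equal labels by injectivity, which is available for labels in
  \<open>B\<close>. Decoded data agree with \<open>F\<close> at indices in range, hence the
  congruence rule for conjunctions.\<close>

lemma code_vertex_state:
  assumes F: "labelled B F" "standard_lgraph F" and inj: "inj_on \<nu> (verts B)" "inj_on \<epsilon> (arcs B)"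
    and l: "l \<in> verts B <+> arcs B"
  shows "code_vertex_state \<nu> \<epsilon> (code_lgraph \<nu> \<epsilon> F) l y \<longleftrightarrow> vertex_state F l y"
proof -
  have "\<nu> (vlab F v) = \<nu> b \<longleftrightarrow> vlab F v = b" if "v \<in> verts (gr F)" "b \<in> verts B" for v b
    using F(1) inj(1) that by (auto simp: labelled_def graph_hom_def inj_on_def)
  moreover have "\<epsilon> (elab F e) = \<epsilon> d \<longleftrightarrow> elab F e = d" if "e \<in> arcs (gr F)" "d \<in> arcs B" for e d
    using F(1) inj(2) that by (auto simp: labelled_def graph_hom_def inj_on_def)
  ultimately show ?thesis
    using l code_lgraph_standard[OF F(2), where \<nu> = \<nu> and \<epsilon> = \<epsilon>] by (cases l) (auto cong: conj_cong)
qed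

lemma code_arc_state:
  assumes F: "labelled B F" "standard_lgraph F" and inj: "inj_on \<epsilon> (arcs B)" and d: "d \<in> arcs B"
  shows "code_arc_state \<epsilon> (code_lgraph \<nu> \<epsilon> F) (i, d, j) y y' \<longleftrightarrow> arc_state F (i, d, j) y y'"
proof -
  have "\<epsilon> (elab F e) = \<epsilon> d \<longleftrightarrow> elab F e = d" if "e \<in> arcs (gr F)" for e
    using F(1) inj d that by (auto simp: labelled_def graph_hom_def inj_on_def)
  then show ?thesis
    using code_lgraph_standard[OF F(2), where \<nu> = \<nu> and \<epsilon> = \<epsilon>] by (cases i; cases j) (simp_all add: Bex_def cong: conj_cong)
qed

text \<open>Numberings onto initial segments make cardinalities bound all labels occurring in codes,
  which keeps the searches below finite.\<close>

locale numbered_simulator =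
  fixes A :: "('a, 'b) pre_digraph" and B :: "('c, 'd) pre_digraph"
    and S :: "('s, 't, 'a, 'b, 'c, 'd) simulator"
    and \<nu> :: "'a \<Rightarrow> nat" and \<epsilon> :: "'b \<Rightarrow> nat" and idx :: "'s \<Rightarrow> nat" and k :: nat
  assumes fin_A: "fin_digraph A" and fin_S: "fin_digraph (sgr S)" and sim: "is_simulator A B S"
    and \<nu>: "bij_betw \<nu> (verts A) {..<card (verts A)}" and \<epsilon>: "bij_betw \<epsilon> (arcs A) {..<card (arcs A)}"
    and idx: "bij_betw idx (verts (sgr S)) {..<k}"
begin

text \<open>
  A vertex of the target graph is the code \<open>x\<close> of a list: entry 0 is the number of its label and
  entry \<open>Suc (idx s)\<close> the state of the vertex \<open>s\<close> of the simulator; entries of vertices \<open>s\<close> with a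
  different label are irrelevant. An arc is the triple \<open>z\<close> that describes it in \<open>code_lgraph\<close>.
\<close>

definition good_vertex :: "('c + 'd \<Rightarrow> nat \<Rightarrow> bool) \<Rightarrow> nat \<Rightarrow> bool" where
  "good_vertex VS x \<longleftrightarrow> (\<exists>a\<in>verts A. list_code_nth x 0 = \<nu> a \<and>
     (\<forall>s\<in>{s \<in> verts (sgr S). alphav S s = a}. VS (betav S s) (list_code_nth x (Suc (idx s)))))"

definition good_arc :: "(bool \<times> 'd \<times> bool \<Rightarrow> nat \<Rightarrow> nat \<Rightarrow> bool) \<Rightarrow> nat \<Rightarrow> nat \<Rightarrow> bool" where
  "good_arc AS l z \<longleftrightarrow>
     fst (prod_decode z) < length (list_decode l) \<and>
     fst (prod_decode (snd (prod_decode z))) < length (list_decode l) \<and>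
     (\<exists>b\<in>arcs A. snd (prod_decode (snd (prod_decode z))) = \<epsilon> b \<and>
        list_code_nth (list_code_nth l (fst (prod_decode z))) 0 = \<nu> (tail A b) \<and>
        list_code_nth (list_code_nth l (fst (prod_decode (snd (prod_decode z))))) 0 = \<nu> (head A b) \<and>
        (\<forall>t\<in>{t \<in> arcs (sgr S). alphae S t = b}. AS (betae S t)
           (list_code_nth (list_code_nth l (fst (prod_decode z))) (Suc (idx (tail (sgr S) t))))
           (list_code_nth (list_code_nth l (fst (prod_decode (snd (prod_decode z)))))
              (Suc (idx (head (sgr S) t))))))"

text \<open>The length \<open>Suc k\<close> leaves room for the label and one state per vertex of
  \<open>S\<close>. Codes of lists of other lengths may pass the filter too; they are harmless, as
  all conditions concern the entries read from the code.\<close>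

definition vertex_list :: "('c + 'd \<Rightarrow> nat \<Rightarrow> bool) \<Rightarrow> nat \<Rightarrow> nat list" where
  "vertex_list VS N = filter (good_vertex VS) [0..<Suc (list_encode (replicate (Suc k) N))]"

definition arc_list :: "(bool \<times> 'd \<times> bool \<Rightarrow> nat \<Rightarrow> nat \<Rightarrow> bool) \<Rightarrow> nat \<Rightarrow> nat list" where
  "arc_list AS l = filter (good_arc AS l) [0..<Suc (prod_encode (length (list_decode l),
     prod_encode (length (list_decode l), card (arcs A))))]"

text \<open>The state conditions are parameters, so that the same construction can be run on
  \<open>F\<close> for the mathematics and on the code of \<open>F\<close> for the
  algorithm.\<close>

definition target_code :: "('c + 'd \<Rightarrow> nat \<Rightarrow> bool) \<Rightarrow> (bool \<times> 'd \<times> bool \<Rightarrow> nat \<Rightarrow> nat \<Rightarrow> bool) \<Rightarrow> nat \<Rightarrow> nat" where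
  "target_code VS AS N = prod_encode
     (list_encode (map (\<lambda>x. list_code_nth x 0) (vertex_list VS N)),
      list_encode (arc_list AS (list_encode (vertex_list VS N))))"

definition target :: "('c + 'd \<Rightarrow> nat \<Rightarrow> bool) \<Rightarrow> (bool \<times> 'd \<times> bool \<Rightarrow> nat \<Rightarrow> nat \<Rightarrow> bool) \<Rightarrow> nat
    \<Rightarrow> (nat, nat, 'a, 'b) lgraph" where
  "target VS AS N = (let L = vertex_list VS N; M = arc_list AS (list_encode L) in
     \<lparr>gr = \<lparr>verts = {..<length L}, arcs = {..<length M},
        tail = (\<lambda>e. fst (prod_decode (M ! e))), head = (\<lambda>e. fst (prod_decode (snd (prod_decode (M ! e)))))\<rparr>,
      vlab = (\<lambda>v. inv_into (verts A) \<nu> (list_code_nth (L ! v) 0)),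
      elab = (\<lambda>e. inv_into (arcs A) \<epsilon> (snd (prod_decode (snd (prod_decode (M ! e))))))\<rparr>)"

section \<open>The target as a standard labelled graph\<close>

lemma inv_\<nu>: "a \<in> verts A \<Longrightarrow> inv_into (verts A) \<nu> (\<nu> a) = a"
  and inv_\<epsilon>: "b \<in> arcs A \<Longrightarrow> inv_into (arcs A) \<epsilon> (\<epsilon> b) = b"
  and inv_idx: "s \<in> verts (sgr S) \<Longrightarrow> inv_into (verts (sgr S)) idx (idx s) = s"
  using \<nu> \<epsilon> idx by (auto simp: bij_betw_def)

lemma good_vertex_nth: "v < length (vertex_list VS N) \<Longrightarrow> good_vertex VS (vertex_list VS N ! v)"
  using nth_mem[of v "vertex_list VS N"] by (auto simp: vertex_list_def)

lemma good_arc_nth: "e < length (arc_list AS l) \<Longrightarrow> good_arc AS l (arc_list AS l ! e)"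
  using nth_mem[of e "arc_list AS l"] by (auto simp: arc_list_def)

lemma target_vertexE:
  assumes "v \<in> verts (gr (target VS AS N))"
  obtains "vlab (target VS AS N) v \<in> verts A"
    "list_code_nth (vertex_list VS N ! v) 0 = \<nu> (vlab (target VS AS N) v)"
    "\<And>s. s \<in> verts (sgr S) \<Longrightarrow> alphav S s = vlab (target VS AS N) v \<Longrightarrow>
       VS (betav S s) (list_code_nth (vertex_list VS N ! v) (Suc (idx s)))"
proof -
  have "good_vertex VS (vertex_list VS N ! v)"
    using assms by (intro good_vertex_nth) (simp add: target_def Let_def)
  then obtain a where a: "a \<in> verts A" "list_code_nth (vertex_list VS N ! v) 0 = \<nu> a"
    "\<And>s. s \<in> verts (sgr S) \<Longrightarrow> alphav S s = a \<Longrightarrow>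
       VS (betav S s) (list_code_nth (vertex_list VS N ! v) (Suc (idx s)))"
    by (auto simp: good_vertex_def)
  moreover have "vlab (target VS AS N) v = a"
    using a by (simp add: target_def Let_def inv_\<nu>)
  ultimately show thesis using that by simp
qed

lemma target_arcE:
  assumes "e \<in> arcs (gr (target VS AS N))"
  obtains "tail (gr (target VS AS N)) e \<in> verts (gr (target VS AS N))"
    "head (gr (target VS AS N)) e \<in> verts (gr (target VS AS N))"
    "elab (target VS AS N) e \<in> arcs A"
    "vlab (target VS AS N) (tail (gr (target VS AS N)) e) = tail A (elab (target VS AS N) e)"
    "vlab (target VS AS N) (head (gr (target VS AS N)) e) = head A (elab (target VS AS N) e)"
    "\<And>t. t \<in> arcs (sgr S) \<Longrightarrow> alphae S t = elab (target VS AS N) e \<Longrightarrow> AS (betae S t)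
       (list_code_nth (vertex_list VS N ! tail (gr (target VS AS N)) e) (Suc (idx (tail (sgr S) t))))
       (list_code_nth (vertex_list VS N ! head (gr (target VS AS N)) e) (Suc (idx (head (sgr S) t))))"
proof -
  let ?T = "target VS AS N" and ?L = "vertex_list VS N"
  define z where "z = arc_list AS (list_encode ?L) ! e"
  have "good_arc AS (list_encode ?L) z"
    unfolding z_def using assms by (intro good_arc_nth) (simp add: target_def Let_def)
  moreover have th: "fst (prod_decode z) = tail (gr ?T) e" "fst (prod_decode (snd (prod_decode z))) = head (gr ?T) e"
    by (simp_all add: target_def Let_def z_def)
  ultimately obtain b where b: "b \<in> arcs A" "snd (prod_decode (snd (prod_decode z))) = \<epsilon> b"
    and lt: "tail (gr ?T) e < length ?L" "head (gr ?T) e < length ?L"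
    and lab: "list_code_nth (?L ! tail (gr ?T) e) 0 = \<nu> (tail A b)"
      "list_code_nth (?L ! head (gr ?T) e) 0 = \<nu> (head A b)"
    and AS: "\<And>t. t \<in> arcs (sgr S) \<Longrightarrow> alphae S t = b \<Longrightarrow> AS (betae S t)
       (list_code_nth (?L ! tail (gr ?T) e) (Suc (idx (tail (sgr S) t))))
       (list_code_nth (?L ! head (gr ?T) e) (Suc (idx (head (sgr S) t))))"
    by (auto simp: good_arc_def)
  have "tail A b \<in> verts A" "head A b \<in> verts A"
    using b(1) fin_A by (auto simp: fin_digraph_def wf_digraph_def)
  then have "vlab ?T (tail (gr ?T) e) = tail A b" "vlab ?T (head (gr ?T) e) = head A b"
    using lab inv_\<nu> by (simp_all add: target_def Let_def)
  moreover have "elab ?T e = b"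
    using b inv_\<epsilon> by (simp add: target_def Let_def z_def)
  moreover have "tail (gr ?T) e \<in> verts (gr ?T)" "head (gr ?T) e \<in> verts (gr ?T)"
    using lt by (simp_all add: target_def Let_def)
  ultimately show thesis using that b AS by simp
qed

lemma wf_target: "wf_digraph (gr (target VS AS N))"
  by (rule wf_digraph.intro; erule target_arcE)

lemma labelled_target: "labelled A (target VS AS N)"
proof -
  have "wf_digraph A" using fin_A by (simp add: fin_digraph_def)
  then show ?thesis unfolding labelled_def graph_hom_def
    using wf_target by (auto elim: target_vertexE target_arcE)
qed

lemma standard_target: "standard_lgraph (target VS AS N)"
  by (auto simp: standard_lgraph_def target_def Let_def)

lemma code_lgraph_target: "code_lgraph \<nu> \<epsilon> (target VS AS N) = target_code VS AS N"
proof -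
  let ?T = "target VS AS N" and ?L = "vertex_list VS N"
  let ?M = "arc_list AS (list_encode ?L)"
  have V: "map (\<lambda>v. \<nu> (vlab ?T v)) [0..<length ?L] = map (\<lambda>x. list_code_nth x 0) ?L"
  proof (rule nth_equalityI)
    fix v assume "v < length (map (\<lambda>v. \<nu> (vlab ?T v)) [0..<length ?L])"
    then have v: "v \<in> verts (gr ?T)" "v < length ?L" by (simp_all add: target_def Let_def)
    from v(1) show "map (\<lambda>v. \<nu> (vlab ?T v)) [0..<length ?L] ! v = map (\<lambda>x. list_code_nth x 0) ?L ! v"
      by (rule target_vertexE) (simp add: v(2))
  qed simp
  have E: "map (\<lambda>e. prod_encode (tail (gr ?T) e, prod_encode (head (gr ?T) e, \<epsilon> (elab ?T e)))) [0..<length ?M] = ?M"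
  proof (rule nth_equalityI)
    fix e assume "e < length (map (\<lambda>e. prod_encode (tail (gr ?T) e, prod_encode (head (gr ?T) e, \<epsilon> (elab ?T e)))) [0..<length ?M])"
    then have e: "e < length ?M" by simp
    \<comment> \<open>Goodness puts the third component of the triple into the range of \<epsilon>,
      so decoding the label and numbering it again changes nothing.\<close>
    then have "good_arc AS (list_encode ?L) (?M ! e)" by (rule good_arc_nth)
    then have "\<epsilon> (elab ?T e) = snd (prod_decode (snd (prod_decode (?M ! e))))"
      using inv_\<epsilon> by (auto simp: good_arc_def target_def Let_def)
    then show "map (\<lambda>e. prod_encode (tail (gr ?T) e, prod_encode (head (gr ?T) e, \<epsilon> (elab ?T e)))) [0..<length ?M] ! e = ?M ! e"
      using e by (simp add: target_def Let_def)
  qed simp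
  have "verts (gr ?T) = {..<length ?L}" "arcs (gr ?T) = {..<length ?M}"
    by (simp_all add: target_def Let_def)
  then show ?thesis by (simp add: code_lgraph_def target_code_def V E)
qed

text \<open>Quantifiers over \<open>A\<close> and \<open>S\<close> range over fixed finite sets and
  are unrolled. Only the enumerations of vertices and arcs and the search for an arc of
  \<open>F\<close> depend on the input, and all are bounded.\<close>

lemma rec_in_target_code:
  fixes \<nu>' :: "'c \<Rightarrow> nat" and \<epsilon>' :: "'d \<Rightarrow> nat"
  shows "rec_in [\<lambda>c. c] (\<lambda>c. target_code (code_vertex_state \<nu>' \<epsilon>' c) (code_arc_state \<epsilon>' c)
    (code_nverts c + code_narcs c + 2 + card (verts A)))"
proof -
  have finA: "finite (verts A)" "finite (arcs A)" 
    and finS: "finite {s \<in> verts (sgr S). Q s}" "finite {t \<in> arcs (sgr S). R t}" for Q R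
    using fin_A fin_S by (auto simp: fin_digraph_def fin_digraph_axioms_def)
  have good_vertex: "dec_in vs (\<lambda>x. good_vertex (code_vertex_state \<nu>' \<epsilon>' (f x)) (y x))"
    if "rec_in vs f" "rec_in vs y" for vs :: "('x \<Rightarrow> nat) list" and f y
    unfolding good_vertex_def by (intro rec_intros that finA finS)
  have good_arc: "dec_in vs (\<lambda>x. good_arc (code_arc_state \<epsilon>' (f x)) (l x) (y x))"
    if "rec_in vs f" "rec_in vs l" "rec_in vs y" for vs :: "('x \<Rightarrow> nat) list" and f l y
    unfolding good_arc_def by (intro rec_intros that finA finS)
  let ?N = "\<lambda>c. code_nverts c + code_narcs c + 2 + card (verts A)"
  have id: "rec_in [\<lambda>c. c] (\<lambda>c. c)" by (rule rec_in_var) simp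
  have N: "rec_in [\<lambda>c. c] (\<lambda>c. Suc (list_encode (replicate (Suc k) (?N c))))"
    by (intro rec_intros id)
  have V: "dec_in (bind_env [\<lambda>c. c]) (\<lambda>z. good_vertex (code_vertex_state \<nu>' \<epsilon>' (snd z)) (fst z))"
    by (intro good_vertex rec_in_bound rec_in_weaken id)
  have L0: "rec_in [\<lambda>c. c] (\<lambda>c. list_encode (map (\<lambda>x. list_code_nth x 0)
      (vertex_list (code_vertex_state \<nu>' \<epsilon>' c) (?N c))))"
    unfolding vertex_list_def by (intro rec_in_map_filter V N rec_intros)
  have L: "rec_in [\<lambda>c. c] (\<lambda>c. list_encode (vertex_list (code_vertex_state \<nu>' \<epsilon>' c) (?N c)))"
    using rec_in_map_filter[OF rec_in_bound V N] by (simp add: vertex_list_def)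
  let ?l = "\<lambda>c. list_encode (vertex_list (code_vertex_state \<nu>' \<epsilon>' c) (?N c))"
  have E: "dec_in (bind_env [\<lambda>c. c]) (\<lambda>z. good_arc (code_arc_state \<epsilon>' (snd z)) (?l (snd z)) (fst z))"
    by (rule good_arc) (intro rec_in_bound rec_in_weaken id L)+
  have M: "rec_in [\<lambda>c. c] (\<lambda>c. Suc (prod_encode (length (list_decode (?l c)),
     prod_encode (length (list_decode (?l c)), card (arcs A)))))"
    by (intro rec_in_Suc rec_in_prod_encode rec_in_length L rec_in_const)
  have "rec_in [\<lambda>c. c] (\<lambda>c. list_encode (arc_list (code_arc_state \<epsilon>' c) (?l c)))"
    using rec_in_map_filter[OF rec_in_bound E M] by (simp add: arc_list_def)
  then show ?thesis unfolding target_code_def by (rule rec_in_prod_encode[OF L0])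
qed

section \<open>Morphisms to the target and state assignments\<close>

lemma state_assignment_if_homs_target:
  assumes "labelled A G" and hom: "lgraph_homs G (target (vertex_state F) (arc_state F) N) \<noteq> {}"
  shows "\<exists>st. state_assignment (pullback G S) F st"
proof -
  let ?T = "target (vertex_state F) (arc_state F) N" and ?L = "vertex_list (vertex_state F) N"
  obtain f g where fg: "(f, g) \<in> lgraph_homs G ?T" using hom by auto
  let ?st = "\<lambda>(v, s). list_code_nth (?L ! f v) (Suc (idx s))"
  have "vertex_state F (betav S s) (?st (v, s))"
    if "v \<in> verts (gr G)" "s \<in> verts (sgr S)" "vlab G v = alphav S s" for v s
  proof -
    have "f v \<in> verts (gr ?T)" "vlab ?T (f v) = vlab G v"
      using fg that(1) by (auto simp: lgraph_homs_def graph_hom_def)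
    with that show ?thesis by (auto elim: target_vertexE)
  qed
  moreover have "arc_state F (betae S t) (?st (tail (gr G) e, tail (sgr S) t)) (?st (head (gr G) e, head (sgr S) t))"
    if "e \<in> arcs (gr G)" "t \<in> arcs (sgr S)" "elab G e = alphae S t" for e t
  proof -
    have "g e \<in> arcs (gr ?T)" "elab ?T (g e) = elab G e"
      "tail (gr ?T) (g e) = f (tail (gr G) e)" "head (gr ?T) (g e) = f (head (gr G) e)"
      using fg that(1) by (auto simp: lgraph_homs_def graph_hom_def)
    with that show ?thesis by (auto elim!: target_arcE)
  qed
  ultimately have "state_assignment (pullback G S) F ?st"
    by (auto simp: state_assignment_def pullback_def)
  then show ?thesis by blast
qed

lemma homs_target_if_state_assignment:
  assumes G: "labelled A G" and st: "state_assignment (pullback G S) F st"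
    and F: "standard_lgraph F" and N: "N = card (verts (gr F)) + card (arcs (gr F)) + 2 + card (verts A)"
  shows "lgraph_homs G (target (vertex_state F) (arc_state F) N) \<noteq> {}"
proof -
  let ?T = "target (vertex_state F) (arc_state F) N" and ?L = "vertex_list (vertex_state F) N"
  let ?M = "arc_list (arc_state F) (list_encode ?L)"
  have wG: "wf_digraph (gr G)" and GA: "\<And>v. v \<in> verts (gr G) \<Longrightarrow> vlab G v \<in> verts A"
    "\<And>e. e \<in> arcs (gr G) \<Longrightarrow> elab G e \<in> arcs A \<and> tail A (elab G e) = vlab G (tail (gr G) e)
       \<and> head A (elab G e) = vlab G (head (gr G) e)"
    using G by (auto simp: labelled_def graph_hom_def)
  have wS: "wf_digraph (sgr S)" and SA: "\<And>t. t \<in> arcs (sgr S) \<Longrightarrow>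
      alphav S (tail (sgr S) t) = tail A (alphae S t) \<and> alphav S (head (sgr S) t) = head A (alphae S t)"
    using sim by (auto simp: is_simulator_def graph_hom_def)
  have stV: "vertex_state F (betav S s) (st (v, s))"
    if "v \<in> verts (gr G)" "s \<in> verts (sgr S)" "vlab G v = alphav S s" for v s
    using st that unfolding state_assignment_def by (force simp: pullback_def)
  have stE: "arc_state F (betae S t) (st (tail (gr G) e, tail (sgr S) t)) (st (head (gr G) e, head (sgr S) t))"
    if "e \<in> arcs (gr G)" "t \<in> arcs (sgr S)" "elab G e = alphae S t" for e t
    using st that unfolding state_assignment_def by (force simp: pullback_def)
  \<comment> \<open>A state is a vertex of \<open>F\<close>, 0, 1, or an arc shifted by 2; the
    summand \<open>card (verts A)\<close> in \<open>N\<close> covers the label in entry 0.\<close>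
  have bound: "y \<le> N" if "vertex_state F l y" for l y
  proof -
    obtain m n where mn: "verts (gr F) = {..<m}" "arcs (gr F) = {..<n}"
      using F unfolding standard_lgraph_def by blast
    have "y < m \<or> y < 2 \<or> y - 2 < n" using that mn by (cases l) auto
    moreover have "N = m + n + 2 + card (verts A)" by (simp add: N mn)
    ultimately show ?thesis by linarith
  qed
  define s where "s j = inv_into (verts (sgr S)) idx j" for j
  \<comment> \<open>The tuple of states over \<open>v\<close>. The value 0 at vertices of
    \<open>S\<close> with another label is a filler below the bound.\<close>
  define xs where "xs v = \<nu> (vlab G v) # map (\<lambda>j. if alphav S (s j) = vlab G v then st (v, s j) else 0) [0..<k]" for v
  have s_idx: "idx u < k" "s (idx u) = u" if "u \<in> verts (sgr S)" for u
    using idx that inv_idx by (auto simp: bij_betw_def s_def)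
  have s_in: "s j \<in> verts (sgr S)" if "j < k" for j
    using idx that unfolding s_def by (metis bij_betw_def inv_into_into lessThan_iff)
  have xs0: "list_code_nth (list_encode (xs v)) 0 = \<nu> (vlab G v)" for v
    using list_code_nth_encode[of 0 "xs v"] by (simp add: xs_def del: list_encode.simps)
  have xs_Suc: "list_code_nth (list_encode (xs v)) (Suc (idx u)) = st (v, u)"
    if "u \<in> verts (sgr S)" "alphav S u = vlab G v" for u v
    using s_idx[OF that(1)] that(2) by (simp add: xs_def del: list_encode.simps)
  have xs_L: "\<exists>i. i < length ?L \<and> ?L ! i = list_encode (xs v)" if v: "v \<in> verts (gr G)" for v
  proof -
    have "good_vertex (vertex_state F) (list_encode (xs v))"
      unfolding good_vertex_def using GA(1)[OF v] xs0 xs_Suc stV[OF v] by auto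
    moreover have "list_encode (xs v) \<le> list_encode (replicate (Suc k) N)"
    proof (rule list_encode_mono)
      have "y \<le> N" if "y \<in> set (xs v)" for y
      proof -
        have "\<nu> (vlab G v) < card (verts A)" using \<nu> GA(1)[OF v] by (auto simp: bij_betw_def)
        moreover have "st (v, s j) \<le> N" if "j < k" "alphav S (s j) = vlab G v" for j
          using bound[OF stV[OF v s_in[OF that(1)]]] that(2) by simp
        ultimately show ?thesis using that N by (auto simp: xs_def split: if_splits)
      qed
      then show "list_all2 (\<le>) (xs v) (replicate (Suc k) N)"
        by (auto simp: list_all2_conv_all_nth xs_def nth_Cons' simp del: replicate_Suc)
    qed
    ultimately have "list_encode (xs v) \<in> set ?L" by (simp add: vertex_list_def less_Suc_eq_le del: upt_Suc)
    then show ?thesis by (simp add: in_set_conv_nth)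
  qed
  \<comment> \<open>Vertices of the target are positions in the list, not the codes stored
    there.\<close>
  define f where "f v = (SOME i. i < length ?L \<and> ?L ! i = list_encode (xs v))" for v
  have f: "f v < length ?L" "?L ! f v = list_encode (xs v)" if "v \<in> verts (gr G)" for v
    using someI_ex[OF xs_L[OF that]] by (simp_all add: f_def)
  define z where "z e = prod_encode (f (tail (gr G) e), prod_encode (f (head (gr G) e), \<epsilon> (elab G e)))" for e
  have z_M: "\<exists>i. i < length ?M \<and> ?M ! i = z e" if e: "e \<in> arcs (gr G)" for e
  proof -
    have th: "tail (gr G) e \<in> verts (gr G)" "head (gr G) e \<in> verts (gr G)"
      using wG e by (auto simp: wf_digraph_def)
    have "good_arc (arc_state F) (list_encode ?L) (z e)"
    proof -
      have "arc_state F (betae S t) (list_code_nth (list_encode (xs (tail (gr G) e))) (Suc (idx (tail (sgr S) t))))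
          (list_code_nth (list_encode (xs (head (gr G) e))) (Suc (idx (head (sgr S) t))))"
        if t: "t \<in> arcs (sgr S)" "alphae S t = elab G e" for t
      proof -
        have "tail (sgr S) t \<in> verts (sgr S)" "head (sgr S) t \<in> verts (sgr S)"
          using wS t by (auto simp: wf_digraph_def)
        moreover have "alphav S (tail (sgr S) t) = vlab G (tail (gr G) e)"
          "alphav S (head (sgr S) t) = vlab G (head (gr G) e)"
          using SA[OF t(1)] GA(2)[OF e] t(2) by simp_all
        ultimately show ?thesis using stE[OF e t(1)] t(2) xs_Suc by simp
      qed
      then show ?thesis
        unfolding good_arc_def using GA(2)[OF e] f[OF th(1)] f[OF th(2)] xs0
        by (auto simp: z_def intro!: bexI[of _ "elab G e"])
    qed
    moreover have "\<epsilon> (elab G e) < card (arcs A)" using \<epsilon> GA(2)[OF e] by (auto simp: bij_betw_def)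
    then have "z e \<le> prod_encode (length ?L, prod_encode (length ?L, card (arcs A)))"
      unfolding z_def using f(1)[OF th(1)] f(1)[OF th(2)] by (intro prod_encode_mono) simp_all
    ultimately have "z e \<in> set ?M" by (simp add: arc_list_def less_Suc_eq_le del: upt_Suc)
    then show ?thesis by (simp add: in_set_conv_nth)
  qed
  define g where "g e = (SOME i. i < length ?M \<and> ?M ! i = z e)" for e
  have g: "g e < length ?M" "?M ! g e = z e" if "e \<in> arcs (gr G)" for e
    using someI_ex[OF z_M[OF that]] by (simp_all add: g_def)
  have "f v \<in> verts (gr ?T) \<and> vlab ?T (f v) = vlab G v" if "v \<in> verts (gr G)" for v
    using f[OF that] xs0 inv_\<nu>[OF GA(1)[OF that]] by (simp add: target_def Let_def)
  moreover have "g e \<in> arcs (gr ?T) \<and> elab ?T (g e) = elab G e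
      \<and> tail (gr ?T) (g e) = f (tail (gr G) e) \<and> head (gr ?T) (g e) = f (head (gr G) e)"
    if "e \<in> arcs (gr G)" for e
    using g[OF that] inv_\<epsilon> GA(2)[OF that] by (simp add: target_def Let_def z_def)
  ultimately have "(f, g) \<in> lgraph_homs G ?T"
    using wG wf_target by (auto simp: lgraph_homs_def graph_hom_def)
  then show ?thesis by auto
qed

text \<open>The conditions are consulted only at labels of \<open>S\<close>, which lie in the path
  subdivision of \<open>B\<close>; there the conditions on \<open>F\<close> and on its code
  coincide.\<close>

lemma target_code_cong:
  assumes "\<And>l y. l \<in> verts B <+> arcs B \<Longrightarrow> VS l y \<longleftrightarrow> VS' l y"
    and "\<And>i d j y y'. d \<in> arcs B \<Longrightarrow> AS (i, d, j) y y' \<longleftrightarrow> AS' (i, d, j) y y'"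
  shows "target_code VS AS N = target_code VS' AS' N"
proof -
  have V: "betav S s \<in> verts B <+> arcs B" if "s \<in> verts (sgr S)" for s
    using sim that by (auto simp: is_simulator_def graph_hom_def path_subdivision_def)
  have "good_vertex VS = good_vertex VS'"
    using assms(1)[OF V] by (auto simp: good_vertex_def fun_eq_iff)
  moreover have "AS (betae S t) = AS' (betae S t)" if "t \<in> arcs (sgr S)" for t
  proof -
    have "betae S t \<in> arcs (path_subdivision B)"
      using sim that by (auto simp: is_simulator_def graph_hom_def)
    then show ?thesis
      using assms(2) by (cases "betae S t") (auto simp: path_subdivision_def fun_eq_iff)
  qed
  then have "good_arc AS = good_arc AS'"
    by (simp add: good_arc_def fun_eq_iff cong: ball_cong)
  ultimately show ?thesis by (simp add: target_code_def vertex_list_def arc_list_def)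
qed

lemma graph_hom_pullback:
  assumes "labelled A G"
  shows "graph_hom (gr (pullback G S)) (path_subdivision B) (vlab (pullback G S)) (elab (pullback G S))"
proof -
  have "wf_digraph (gr (pullback G S))"
    using assms sim unfolding labelled_def is_simulator_def graph_hom_def pullback_def
    by (intro wf_digraph.intro) (auto simp: wf_digraph_def)
  then show ?thesis
    using sim unfolding is_simulator_def graph_hom_def by (auto simp: pullback_def)
qed

text \<open>\<open>N\<close> is arbitrary here, as whatever vertices the target contains obey the
  state conditions.\<close>

lemma homs_target_imp_homs_simulate:
  assumes G: "labelled A G" and F: "labelled B F"
    and hom: "lgraph_homs G (target (vertex_state F) (arc_state F) N) \<noteq> {}"
  shows "lgraph_homs (G \<rtimes> S) F \<noteq> {}"
proof -
  obtain st where "state_assignment (pullback G S) F st"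
    using state_assignment_if_homs_target[OF G hom] by blast
  moreover have "wf_digraph (gr (flat (pullback G S)))" "wf_digraph (gr F)"
    using labelled_simulate[OF G sim] F by (auto simp: labelled_def graph_hom_def simulate_def)
  ultimately show ?thesis
    unfolding simulate_def using flat_homs_if_state_assignment[OF graph_hom_pullback[OF G]] by blast
qed

text \<open>Here \<open>N\<close> is large enough for the target to contain every tuple of states
  that can arise, and etaleness provides the states.\<close>

lemma homs_simulate_imp_homs_target:
  assumes G: "labelled A G" and F: "standard_lgraph F"
    and N: "N = card (verts (gr F)) + card (arcs (gr F)) + 2 + card (verts A)"
    and "weakly_etale (G \<rtimes> S)" "lgraph_homs (G \<rtimes> S) F \<noteq> {}"
  shows "lgraph_homs G (target (vertex_state F) (arc_state F) N) \<noteq> {}"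
  using state_assignment_if_flat_homs[OF graph_hom_pullback[OF G]] assms(4,5)
    homs_target_if_state_assignment[OF G _ F N]
  unfolding simulate_def by blast

end

section \<open>Reduction of the tiling problem for \<Delta> to that for \<Gamma>\<close>

theorem theorem3p6:
  fixes A :: "('a, 'b) pre_digraph"
    and B :: "('c, 'd) pre_digraph"
    and \<Gamma> :: "('v, 'e, 'a, 'b) lgraph set"
    and \<Delta> :: "('w, 'f, 'c, 'd) lgraph set"
    and S :: "('s, 't, 'a, 'b, 'c, 'd) simulator"
  assumes "fin_digraph A"
    and "fin_digraph B"
    and "\<And>G. G \<in> \<Gamma> \<Longrightarrow> labelled A G"
    and "\<And>H. H \<in> \<Delta> \<Longrightarrow> labelled B H"
    and "is_simulator A B S"
    and "fin_digraph (sgr S)"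
    and "\<And>H. H \<in> \<Delta> \<Longrightarrow> \<exists>G \<in> \<Gamma>. weakly_etale (G \<rtimes> S) \<and> weakly_maps (G \<rtimes> S) H"
    and "\<And>G. G \<in> \<Gamma> \<Longrightarrow> \<exists>H \<in> \<Delta>. weakly_maps H (G \<rtimes> S)"
    and "tiling_solvable A \<Gamma>"
  shows "tiling_solvable B \<Delta>"
  unfolding tiling_solvable_def
proof (intro allI impI)
  fix \<nu>' :: "'c \<Rightarrow> nat" and \<epsilon>' :: "'d \<Rightarrow> nat"
  assume inj: "inj_on \<nu>' (verts B) \<and> inj_on \<epsilon>' (arcs B)"
  have fin: "finite (verts A)" "finite (arcs A)" "finite (verts (sgr S))"
    using assms(1,6) by (auto simp: fin_digraph_def fin_digraph_axioms_def)
  \<comment> \<open>The numbering of \<open>A\<close> may be chosen, since solvability provides an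
    algorithm for each; that of \<open>B\<close> is given.\<close>
  obtain \<nu> where \<nu>: "bij_betw \<nu> (verts A) {..<card (verts A)}"
    using ex_bij_betw_finite_nat[OF fin(1)] by (auto simp: atLeast0LessThan)
  obtain \<epsilon> where \<epsilon>: "bij_betw \<epsilon> (arcs A) {..<card (arcs A)}"
    using ex_bij_betw_finite_nat[OF fin(2)] by (auto simp: atLeast0LessThan)
  obtain idx where idx: "bij_betw idx (verts (sgr S)) {..<card (verts (sgr S))}"
    using ex_bij_betw_finite_nat[OF fin(3)] by (auto simp: atLeast0LessThan)
  interpret numbered_simulator A B S \<nu> \<epsilon> idx "card (verts (sgr S))"
    by (rule numbered_simulator.intro) (fact assms \<nu> \<epsilon> idx)+
  have "inj_on \<nu> (verts A) \<and> inj_on \<epsilon> (arcs A)"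
    using \<nu> \<epsilon> by (simp add: bij_betw_def)
  from assms(9)[unfolded tiling_solvable_def, rule_format, OF this]
  obtain p where p: "\<forall>F :: (nat, nat, 'a, 'b) lgraph. labelled A F \<and> standard_lgraph F \<longrightarrow>
      computes p [code_lgraph \<nu> \<epsilon> F] (if \<exists>G \<in> \<Gamma>. lgraph_homs G F \<noteq> {} then 1 else 0)" ..
  obtain q where q: "\<And>c. computes q [c] (target_code (code_vertex_state \<nu>' \<epsilon>' c)
      (code_arc_state \<epsilon>' c) (code_nverts c + code_narcs c + 2 + card (verts A)))"
    using rec_in_target_code[of \<nu>' \<epsilon>'] unfolding rec_in_def list.map by (elim exE) (rule that, erule spec)
  \<comment> \<open>\<open>q\<close> turns the code of \<open>F\<close> into that of the target, on
    which \<open>p\<close> decides the problem for \<Gamma>.\<close>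
  have "computes (Comp p [q]) [code_lgraph \<nu>' \<epsilon>' F] (if \<exists>H \<in> \<Delta>. lgraph_homs H F \<noteq> {} then 1 else 0)"
    if F: "labelled B F" "standard_lgraph F" for F
  proof -
    let ?c = "code_lgraph \<nu>' \<epsilon>' F"
    define N where "N = card (verts (gr F)) + card (arcs (gr F)) + 2 + card (verts A)"
    let ?T = "target (vertex_state F) (arc_state F) N"
    have "code_nverts ?c + code_narcs ?c + 2 + card (verts A) = N"
      by (simp add: N_def code_lgraph_def code_nverts_def code_narcs_def)
    moreover have "target_code (code_vertex_state \<nu>' \<epsilon>' ?c) (code_arc_state \<epsilon>' ?c) N
        = target_code (vertex_state F) (arc_state F) N"
      using inj by (intro target_code_cong code_vertex_state[OF F] code_arc_state[OF F]) auto
    ultimately have "computes q [?c] (code_lgraph \<nu> \<epsilon> ?T)"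
      using q[of ?c] by (simp add: code_lgraph_target)
    \<comment> \<open>Each hypothesis on the families serves one direction: some \<open>H\<close>
      weakly maps to \<open>G \<rtimes> S\<close>, respectively some weakly etale
      \<open>G \<rtimes> S\<close> weakly maps to \<open>H\<close>. Compactness composes these with
      a morphism to the finite \<open>F\<close>.\<close>
    moreover have "(\<exists>G \<in> \<Gamma>. lgraph_homs G ?T \<noteq> {}) \<longleftrightarrow> (\<exists>H \<in> \<Delta>. lgraph_homs H F \<noteq> {})"
    proof (intro iffI; elim bexE)
      fix G assume G: "G \<in> \<Gamma>" "lgraph_homs G ?T \<noteq> {}"
      then have "lgraph_homs (G \<rtimes> S) F \<noteq> {}"
        using homs_target_imp_homs_simulate[OF assms(3)[OF G(1)] F(1)] by blast
      moreover obtain H where H: "H \<in> \<Delta>" "weakly_maps H (G \<rtimes> S)" using assms(8)[OF G(1)] by auto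
      ultimately have "lgraph_homs H F \<noteq> {}"
        using lgraph_homs_if_weakly_maps_trans[OF assms(4)[OF H(1)] F] by blast
      with H(1) show "\<exists>H \<in> \<Delta>. lgraph_homs H F \<noteq> {}" by blast
    next
      fix H assume H: "H \<in> \<Delta>" "lgraph_homs H F \<noteq> {}"
      then obtain G where G: "G \<in> \<Gamma>" "weakly_etale (G \<rtimes> S)" "weakly_maps (G \<rtimes> S) H"
        using assms(7) by blast
      have "labelled B (G \<rtimes> S)" by (rule labelled_simulate[OF assms(3)[OF G(1)] assms(5)])
      then have "lgraph_homs (G \<rtimes> S) F \<noteq> {}"
        using lgraph_homs_if_weakly_maps_trans[OF _ F G(3) H(2)] by blast
      then have "lgraph_homs G ?T \<noteq> {}"
        using homs_simulate_imp_homs_target[OF assms(3)[OF G(1)] F(2) N_def G(2)] by blast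
      with G(1) show "\<exists>G \<in> \<Gamma>. lgraph_homs G ?T \<noteq> {}" by blast
    qed
    ultimately show ?thesis
      using p[rule_format, OF conjI[OF labelled_target standard_target], of "vertex_state F" "arc_state F" N]
      by (intro Comp[where ys = "[code_lgraph \<nu> \<epsilon> ?T]"]) simp_all
  qed
  then show "\<exists>p. \<forall>F :: (nat, nat, 'c, 'd) lgraph. labelled B F \<and> standard_lgraph F \<longrightarrow>
      computes p [code_lgraph \<nu>' \<epsilon>' F] (if \<exists>H \<in> \<Delta>. lgraph_homs H F \<noteq> {} then 1 else 0)"
    by blast
qed

end
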